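(* Let $q$ be a prime power, $n\ge1$, and $x_1,\dots,x_n$ positive reals with $x_1+\cdots+x_n=1$. Let $\Psi(q,{\sf x})$ be the stationary distribution of the $q$-Tsetlin library $\mathcal{T}_{G/B}(q,{\sf x})$ on complete flags of $\mathbb{F}_q^n$. Then $\Psi(q,{\sf x})_F=\Psi(q,{\sf x})_{F'}$ whenever $F,F'\in[\pi]$ for some $\pi\in\mathfrak{S}_n$, and \[ \Psi(q,{\sf x})_{F_\pi}=\prod_{k=1}^n\frac{f(\pi_1,\dots,\pi_k)}{x_1+\cdots+x_n-\sum_{s\in\{\pi_1,\dots,\pi_{k-1}\}}\frac{x_s}{q^{n-s-b_k(s)}}}, \qquad f(\pi_1,\dots,\pi_k)=\sum_{\substack{s\in\{\pi_1,\dots,\pi_k\}\\ s\le\pi_k}}\frac{x_s}{q^{n-s-b_k(s)}(x_1+\cdots+x_n)}(q-1)^{\chi(s<\pi_k)}, \] where $b_k(s)=\#\{t\in\{\pi_1,\dots,\pi_{k-1}\}: t>s\}$ and $\chi(s<\pi_k)$ is $1$ if $s<\pi_k$ and $0$ otherwise. Moreover $\sum_{F}\Psi(q,{\sf x})_F=1$, the sum over all complete flags.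
   Context: Let $e_1,\dots,e_n$ be the standard basis of $\mathbb{F}_q^n$. A complete flag is $F=(V_0\subseteq V_1\subseteq\cdots\subseteq V_n)$ of subspaces with $\dim V_i=i$. Every line $L\subseteq\mathbb{F}_q^n$ can be written uniquely as $L=\langle e_i+\sum_{k>i}c_ke_k\rangle$ with $c_k\in\mathbb{F}_q$; its weight is $y(L)=x_i/q^{n-i}$. The $q$-Tsetlin library on flags is the linear operator on the real vector space with basis the complete flags given by $F\cdot\mathcal{T}_{G/B}(q,{\sf x})=\sum_{\text{lines }L}y(L)\,F_L$, where $F_L$ is the complete flag $(V_0\subseteq L\subseteq V_1+L\subseteq\cdots\subseteq V_{n-1}+L\subseteq V_n)$ with the (unique) repeated subspace removed; the coefficients define a Markov chain on complete flags, and its stationary distribution is a probability vector $\Psi$ with $\Psi\cdot\mathcal{T}_{G/B}(q,{\sf x})=\Psi$. For $\pi\in\mathfrak{S}_n$ (one-line notation) $F_\pi$ is the flag with $V_k=\langle e_{\pi_1},\dots,e_{\pi_k}\rangle$, and $[\pi]=\{bF_\pi: b\in B^-\}$ where $B^-$ is the group of invertible lower triangular matrices over $\mathbb{F}_q$ (equivalently the cosets in the double coset $B^-P_\pi B$, $P_\pi$ the permutation matrix with $1$ in entries $(\pi_j,j)$, $B$ the invertible upper triangular matrices); the sets $[\pi]$ partition the set of complete flags. *)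

theory Defs
  imports Complex_Main "HOL-Library.Function_Algebras" "HOL-Library.Set_Algebras"
    "HOL-Library.Cardinality" "HOL-Combinatorics.Permutations"
begin

section \<open>Vectors and subspaces\<close>

text \<open>The field with q elements is a type \<open>'a\<close> of class field and finite, with \<open>q = CARD('a)\<close>.
  Since the order of the basis matters, vectors of length n are functions on \<open>nat\<close> vanishing
  outside \<open>{1..n}\<close>; addition is pointwise (Function_Algebras), and addition of subspaces
  is elementwise (Set_Algebras).\<close>

definition vscale :: "'a::field \<Rightarrow> (nat \<Rightarrow> 'a) \<Rightarrow> nat \<Rightarrow> 'a" where
  "vscale c v = (\<lambda>i. c * v i)"

interpretation fvec: vector_space vscale
  by unfold_locales (auto simp: vscale_def fun_eq_iff algebra_simps)

definition vecs :: "nat \<Rightarrow> (nat \<Rightarrow> 'a::field) set" where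
  "vecs n = {v. \<forall>i. i \<notin> {1..n} \<longrightarrow> v i = 0}"

definition basis_vec :: "nat \<Rightarrow> nat \<Rightarrow> 'a::field" where
  "basis_vec i = (\<lambda>j. if j = i then 1 else 0)"

definition subspaces :: "nat \<Rightarrow> nat \<Rightarrow> (nat \<Rightarrow> 'a::field) set set" where
  "subspaces n d = {V. V \<subseteq> vecs n \<and> fvec.subspace V \<and> fvec.dim V = d}"


section \<open>Complete flags and the q-Tsetlin library\<close>

text \<open>A flag is the list of its subspaces, starting with the zero space.\<close>

type_synonym 'a flag = "(nat \<Rightarrow> 'a) set list"

definition complete_flags :: "nat \<Rightarrow> 'a::field flag set" where
  "complete_flags n = {F. length F = Suc n \<and> (\<forall>i\<le>n. F ! i \<in> subspaces n i) \<and>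
     (\<forall>i<n. F ! i \<subseteq> F ! Suc i)}"

definition line_index :: "nat \<Rightarrow> (nat \<Rightarrow> 'a::field) set \<Rightarrow> nat" where
  "line_index n L = (THE i. i \<in> {1..n} \<and>
     (\<exists>c. L = fvec.span {basis_vec i + (\<Sum>k\<in>{i<..n}. vscale (c k) (basis_vec k))}))"

definition line_weight :: "nat \<Rightarrow> (nat \<Rightarrow> real) \<Rightarrow> (nat \<Rightarrow> 'a::{field,finite}) set \<Rightarrow> real" where
  "line_weight n x L =
     x (line_index n L) / real CARD('a) ^ (n - line_index n L)"

text \<open>The list below is an increasing chain of n + 2 subspaces in which exactly one is repeated;
  equal subspaces in a chain are adjacent.\<close>

definition add_line :: "nat \<Rightarrow> 'a::field flag \<Rightarrow> (nat \<Rightarrow> 'a) set \<Rightarrow> 'a flag" where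
  "add_line n F L = remdups_adj ([F ! 0, L] @ map (\<lambda>i. F ! i + L) [1..<n] @ [F ! n])"

text \<open>A vector in the real space with basis the complete flags is a function \<open>\<Psi>\<close> vanishing off
  the complete flags; the operator acts on row vectors from the right.\<close>

definition tsetlin :: "nat \<Rightarrow> (nat \<Rightarrow> real) \<Rightarrow> ('a::{field,finite} flag \<Rightarrow> real) \<Rightarrow> 'a flag \<Rightarrow> real" where
  "tsetlin n x \<Psi> = (\<lambda>G. \<Sum>F\<in>complete_flags n. \<Psi> F *
     (\<Sum>L\<in>{L \<in> subspaces n 1. add_line n F L = G}. line_weight n x L))"

definition is_stationary_distribution ::
    "nat \<Rightarrow> (nat \<Rightarrow> real) \<Rightarrow> ('a::{field,finite} flag \<Rightarrow> real) \<Rightarrow> bool" where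
  "is_stationary_distribution n x \<Psi> \<longleftrightarrow>
     (\<forall>F. F \<notin> complete_flags n \<longrightarrow> \<Psi> F = 0) \<and>
     (\<forall>F\<in>complete_flags n. 0 \<le> \<Psi> F) \<and> (\<Sum>F\<in>complete_flags n. \<Psi> F) = 1 \<and>
     tsetlin n x \<Psi> = \<Psi>"

definition stationary_distribution ::
    "nat \<Rightarrow> (nat \<Rightarrow> real) \<Rightarrow> 'a::{field,finite} flag \<Rightarrow> real" where
  "stationary_distribution n x = (THE \<Psi>. is_stationary_distribution n x \<Psi>)"


section \<open>Orbits of the lower triangular group\<close>

text \<open>Only the entries of a matrix with indices in \<open>{1..n}\<close> are relevant.\<close>

definition invertible_matrix :: "nat \<Rightarrow> (nat \<Rightarrow> nat \<Rightarrow> 'a::field) \<Rightarrow> bool" where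
  "invertible_matrix n b \<longleftrightarrow> (\<exists>c. \<forall>i\<in>{1..n}. \<forall>k\<in>{1..n}.
     (\<Sum>j=1..n. b i j * c j k) = (if i = k then 1 else 0) \<and>
     (\<Sum>j=1..n. c i j * b j k) = (if i = k then 1 else 0))"

definition lower_borel :: "nat \<Rightarrow> (nat \<Rightarrow> nat \<Rightarrow> 'a::field) set" where
  "lower_borel n = {b. invertible_matrix n b \<and>
     (\<forall>i\<in>{1..n}. \<forall>j\<in>{1..n}. i < j \<longrightarrow> b i j = 0)}"

definition mat_vec :: "nat \<Rightarrow> (nat \<Rightarrow> nat \<Rightarrow> 'a::field) \<Rightarrow> (nat \<Rightarrow> 'a) \<Rightarrow> nat \<Rightarrow> 'a" where
  "mat_vec n b v = (\<lambda>i. if i \<in> {1..n} then \<Sum>j=1..n. b i j * v j else 0)"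

definition act_flag :: "nat \<Rightarrow> (nat \<Rightarrow> nat \<Rightarrow> 'a::field) \<Rightarrow> 'a flag \<Rightarrow> 'a flag" where
  "act_flag n b F = map (\<lambda>V. mat_vec n b ` V) F"

definition perm_flag :: "nat \<Rightarrow> (nat \<Rightarrow> nat) \<Rightarrow> 'a::field flag" where
  "perm_flag n \<pi> = map (\<lambda>k. fvec.span ((\<lambda>j. basis_vec (\<pi> j)) ` {1..k})) [0..<Suc n]"

definition perm_class :: "nat \<Rightarrow> (nat \<Rightarrow> nat) \<Rightarrow> 'a::field flag set" where
  "perm_class n \<pi> = {act_flag n b (perm_flag n \<pi>) | b. b \<in> lower_borel n}"


section \<open>The ingredients of the product formula\<close>

definition b_count :: "(nat \<Rightarrow> nat) \<Rightarrow> nat \<Rightarrow> nat \<Rightarrow> nat" where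
  "b_count \<pi> k s = card {t \<in> \<pi> ` {1..<k}. s < t}"

text \<open>For a permutation of \<open>{1..n}\<close> the exponent \<open>n - s - b_count \<pi> k s\<close> is never truncated,
  because the counted elements lie in \<open>{s<..n}\<close>.\<close>

definition f_factor :: "nat \<Rightarrow> nat \<Rightarrow> (nat \<Rightarrow> real) \<Rightarrow> (nat \<Rightarrow> nat) \<Rightarrow> nat \<Rightarrow> real" where
  "f_factor q n x \<pi> k = (\<Sum>s\<in>{s \<in> \<pi> ` {1..k}. s \<le> \<pi> k}.
     x s / (real q ^ (n - s - b_count \<pi> k s) * (\<Sum>i=1..n. x i))
       * (real q - 1) ^ (if s < \<pi> k then 1 else 0))"

end

(* Transfer the weight of a line evenly to its nonzero vectors, so that the weight of a vector v
   depends only on the position of its first nonzero entry. The stationary distribution is the law of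
   the flag spanned by a sequence of independent random vectors (each subspace of the flag is extended
   by the first vector outside it): putting one more vector in front of the sequence does not change
   this law. The transition probabilities are quotients of weights of sets of vectors, which
   lower triangular matrices preserve and which are explicit for spaces spanned by basis vectors.
   Uniqueness holds because some flag can be reached from every flag. *)

theory Submission
  imports Defs
begin

section \<open>Subspaces and coordinate spaces\<close>

text \<open>If \<open>F\<close> is generated by v1, v2, ..., then one step of the chain yields the
  flag generated by v, v1, v2, ..., with v a uniform nonzero vector of the chosen line. Infinite
  sequences are avoided: given the space U reached so far, the first later vector outside U has the
  weight conditioned to the complement of U, so the law of the flag is a finite recursion on U.
  Inserting v then becomes an identity between two such recursions, stated for every starting space
  U because the induction leaves {0}. Passing from lines to vectors turns the weight into a measure
  on sets of vectors: the k-th denominator of the theorem is the measure of the complement of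
  V_(k-1), and f is the measure of V_k minus V_(k-1). In a span of basis vectors there are (q-1) q^m
  vectors with first nonzero entry s, where m counts the basis indices above s. Adjoining an index
  above s changes q^m to q^(m+1), and the difference is the source of the factor (q-1)^chi.\<close>

definition adjoin :: "(nat \<Rightarrow> 'a::field) set \<Rightarrow> (nat \<Rightarrow> 'a) \<Rightarrow> (nat \<Rightarrow> 'a) set" where
  "adjoin U v = U + fvec.span {v}"

definition coord_space :: "nat set \<Rightarrow> (nat \<Rightarrow> 'a::field) set" where
  "coord_space S = {v. \<forall>i. i \<notin> S \<longrightarrow> v i = 0}"

lemma vecs_eq_coord_space: "vecs n = coord_space {1..n}"
  by (simp add: vecs_def coord_space_def)

lemma mem_adjoin: "w \<in> adjoin U v \<longleftrightarrow> (\<exists>u\<in>U. \<exists>c. w = u + vscale c v)"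
  unfolding adjoin_def set_plus_def by (auto simp: fvec.span_singleton)

lemma adjoin_eq_image: "adjoin U v = (\<lambda>(u, c). u + vscale c v) ` (U \<times> UNIV)"
  by (force simp: mem_adjoin)

lemma subset_adjoin: "U \<subseteq> adjoin U v"
  unfolding subset_iff mem_adjoin by (metis add.right_neutral fvec.scale_zero_left)

lemma self_in_adjoin: "fvec.subspace U \<Longrightarrow> v \<in> adjoin U v"
  unfolding mem_adjoin by (metis add.left_neutral fvec.scale_one fvec.subspace_0)

lemma adjoin_eq_span:
  assumes "fvec.subspace U"
  shows "adjoin U v = fvec.span (insert v U)"
proof -
  have "fvec.span (U \<union> {v}) = {u + w | u w. u \<in> fvec.span U \<and> w \<in> fvec.span {v}}"
    by (rule fvec.span_Un)
  also have "\<dots> = adjoin U v"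
    using assms by (auto simp: adjoin_def set_plus_def fvec.span_eq_iff[THEN iffD2])
  finally show ?thesis by simp
qed

lemma subspace_adjoin: "fvec.subspace U \<Longrightarrow> fvec.subspace (adjoin U v)"
  by (simp add: adjoin_eq_span)

lemma adjoin_least:
  assumes "fvec.subspace W" "U \<subseteq> W" "v \<in> W"
  shows "adjoin U v \<subseteq> W"
  using assms by (auto simp: mem_adjoin intro!: fvec.subspace_add fvec.subspace_scale)

lemma adjoin_absorb: "fvec.subspace U \<Longrightarrow> v \<in> U \<Longrightarrow> adjoin U v = U"
  by (simp add: adjoin_least subset_adjoin subset_antisym)

lemma adjoin_zero: "adjoin {0} v = fvec.span {v}"
  by (simp add: adjoin_def set_plus_def)

lemma adjoin_commute: "adjoin (adjoin U v) w = adjoin (adjoin U w) v"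
  by (simp add: adjoin_def add.assoc add.commute[of "fvec.span {v}"])

text \<open>The coefficient of \<open>v\<close> in \<open>w\<close> cannot vanish, so
  \<open>v\<close> can be solved for. Hence the next space of a random flag depends only on which
  extension of \<open>U\<close> the drawn vector falls into.\<close>

lemma exchange:
  assumes "fvec.subspace U" "w \<in> adjoin U v" "w \<notin> U"
  shows "adjoin U w = adjoin U v"
proof
  show "adjoin U w \<subseteq> adjoin U v"
    using assms by (simp add: adjoin_least subset_adjoin subspace_adjoin)
  obtain u c where u: "u \<in> U" "w = u + vscale c v"
    using assms(2) by (auto simp: mem_adjoin)
  with assms have "c \<noteq> 0" by auto
  then have "v = vscale (1 / c) (w - u)"
    using u by (simp add: fvec.scale_right_distrib)
  also have "\<dots> = vscale (- 1 / c) u + vscale (1 / c) w"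
    by (simp add: vscale_def fun_eq_iff algebra_simps)
  finally have "v \<in> adjoin U w"
    using u assms(1) fvec.subspace_scale mem_adjoin by blast
  then show "adjoin U v \<subseteq> adjoin U w"
    using assms by (simp add: adjoin_least subset_adjoin subspace_adjoin)
qed

lemma card_adjoin:
  fixes U :: "(nat \<Rightarrow> 'a::{field,finite}) set"
  assumes "fvec.subspace U" "v \<notin> U"
  shows "card (adjoin U v) = CARD('a) * card U"
proof -
  have "inj_on (\<lambda>(u, c). u + vscale c v) (U \<times> UNIV)"
  proof (rule inj_onI, clarify)
    fix u u' c c'
    assume u: "u \<in> U" "u' \<in> U" and eq: "u + vscale c v = u' + vscale c' v"
    then have d: "vscale (c - c') v = u' - u"
      by (simp add: fvec.scale_left_diff_distrib algebra_simps)
    have "c = c'"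
    proof (rule ccontr)
      assume "c \<noteq> c'"
      then have "v = vscale (1 / (c - c')) (u' - u)"
        by (simp flip: d)
      then show False
        using u assms fvec.subspace_diff fvec.subspace_scale by metis
    qed
    then show "u = u' \<and> c = c'" using eq by simp
  qed
  then show ?thesis
    by (simp add: adjoin_eq_image card_image card_cartesian_product)
qed

section \<open>Subspaces spanned by basis vectors\<close>

lemma subspace_coord_space: "fvec.subspace (coord_space S)"
  by (rule fvec.subspaceI) (auto simp: coord_space_def vscale_def)

lemma coord_space_empty: "coord_space {} = {0}"
  by (auto simp: coord_space_def)

lemma basis_vec_in_coord_space: "(basis_vec s :: nat \<Rightarrow> 'a::field) \<in> coord_space S \<longleftrightarrow> s \<in> S"
  by (auto simp: coord_space_def basis_vec_def)

lemma coord_space_mono: "S \<subseteq> T \<Longrightarrow> coord_space S \<subseteq> coord_space T"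
  by (auto simp: coord_space_def)

lemma coord_space_insert: "coord_space (insert s S) = adjoin (coord_space S) (basis_vec s)"
proof
  show "adjoin (coord_space S) (basis_vec s) \<subseteq> (coord_space (insert s S) :: (nat \<Rightarrow> 'a) set)"
    by (rule adjoin_least) (auto simp: subspace_coord_space basis_vec_in_coord_space
        intro: subsetD[OF coord_space_mono, rotated])
  show "(coord_space (insert s S) :: (nat \<Rightarrow> 'a) set) \<subseteq> adjoin (coord_space S) (basis_vec s)"
  proof
    fix v :: "nat \<Rightarrow> 'a" assume v: "v \<in> coord_space (insert s S)"
    have "v = v(s := 0) + vscale (v s) (basis_vec s)"
      by (auto simp: fun_eq_iff vscale_def basis_vec_def)
    moreover have "v(s := 0) \<in> coord_space S"
      using v by (auto simp: coord_space_def)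
    ultimately show "v \<in> adjoin (coord_space S) (basis_vec s)"
      unfolding mem_adjoin by blast
  qed
qed

lemma coord_space_eq_span: "finite S \<Longrightarrow> coord_space S = fvec.span (basis_vec ` S)"
proof (induction S rule: finite_induct)
  case (insert s S)
  then show ?case
    by (simp add: coord_space_insert adjoin_eq_span fvec.span_insert[of _ "_ ` _"]
        fvec.span_insert[of _ "fvec.span _"] fvec.span_span)
qed (simp add: coord_space_empty)

lemma card_coord_space:
  "finite S \<Longrightarrow> card (coord_space S :: (nat \<Rightarrow> 'a::{field,finite}) set) = CARD('a) ^ card S"
  by (induction S rule: finite_induct)
    (simp_all add: coord_space_insert coord_space_empty card_adjoin subspace_coord_space
      basis_vec_in_coord_space)

lemma field_card_gt_one: "1 < CARD('a::{field,finite})"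
proof -
  have "card {0, 1 :: 'a} \<le> CARD('a)" by (rule card_mono) auto
  then show ?thesis by simp
qed

lemma finite_coord_space: "finite S \<Longrightarrow> finite (coord_space S :: (nat \<Rightarrow> 'a::{field,finite}) set)"
  using card_coord_space[where 'a = 'a] field_card_gt_one[where 'a = 'a]
  by (metis card.infinite power_not_zero not_one_less_zero)

lemma finite_vecs: "finite (vecs n :: (nat \<Rightarrow> 'a::{field,finite}) set)"
  by (simp add: vecs_eq_coord_space finite_coord_space)

lemma card_vecs: "card (vecs n :: (nat \<Rightarrow> 'a::{field,finite}) set) = CARD('a) ^ n"
  by (simp add: vecs_eq_coord_space card_coord_space)

lemma subspace_vecs: "fvec.subspace (vecs n)"
  by (simp add: vecs_eq_coord_space subspace_coord_space)

section \<open>Dimension measured by cardinality\<close>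

lemma card_span_independent:
  fixes B :: "(nat \<Rightarrow> 'a::{field,finite}) set"
  assumes "finite B" "fvec.independent B"
  shows "card (fvec.span B) = CARD('a) ^ card B"
  using assms
proof (induction B rule: finite_induct)
  case (insert b B)
  then have B: "fvec.independent B" "b \<notin> fvec.span B"
    by (auto simp: fvec.independent_insert split: if_splits)
  have "fvec.span (insert b B) = adjoin (fvec.span B) b"
    by (simp add: adjoin_eq_span fvec.span_insert[of _ B] fvec.span_insert[of _ "fvec.span _"] fvec.span_span)
  then show ?case using insert B by (simp add: card_adjoin)
qed simp

lemma card_subspace:
  fixes V :: "(nat \<Rightarrow> 'a::{field,finite}) set"
  assumes "fvec.subspace V" "V \<subseteq> vecs n"
  shows "card V = CARD('a) ^ fvec.dim V"
proof -
  obtain B where B: "B \<subseteq> V" "fvec.independent B" "V \<subseteq> fvec.span B" "card B = fvec.dim V"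
    using fvec.basis_exists by metis
  then have "fvec.span B = V"
    using assms(1) fvec.span_mono[OF B(1)] fvec.span_eq_iff[THEN iffD2, OF assms(1)] by auto
  moreover have "finite B"
    using B(1) assms(2) finite_vecs finite_subset by (metis subset_trans)
  ultimately show ?thesis using card_span_independent B by metis
qed

text \<open>Over a finite field the size q^d determines d, so dimension arguments become counting
  and follow from \<open>card_adjoin\<close>.\<close>

lemma subspaces_iff_card:
  fixes V :: "(nat \<Rightarrow> 'a::{field,finite}) set"
  shows "V \<in> subspaces n d \<longleftrightarrow> V \<subseteq> vecs n \<and> fvec.subspace V \<and> card V = CARD('a) ^ d"
  using card_subspace[of V n] field_card_gt_one[where 'a = 'a]
  by (auto simp: subspaces_def power_inject_exp)

lemma subspacesD:
  assumes "V \<in> subspaces n d"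
  shows "fvec.subspace V" "V \<subseteq> vecs n" "0 \<in> V"
  using assms by (auto simp: subspaces_def fvec.subspace_0)

lemma adjoin_in_subspaces:
  fixes U :: "(nat \<Rightarrow> 'a::{field,finite}) set"
  assumes "U \<in> subspaces n d" "v \<in> vecs n" "v \<notin> U"
  shows "adjoin U v \<in> subspaces n (Suc d)"
  using assms by (simp add: subspaces_iff_card card_adjoin subspace_adjoin adjoin_least subspace_vecs)

lemma adjoin_eq_subspace:
  fixes U :: "(nat \<Rightarrow> 'a::{field,finite}) set"
  assumes "U \<in> subspaces n d" "W \<in> subspaces n (Suc d)" "U \<subseteq> W" "v \<in> W" "v \<notin> U"
  shows "adjoin U v = W"
proof (rule card_subset_eq)
  show "finite W" using assms(2) finite_vecs finite_subset subspacesD(2) by metis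
  show "adjoin U v \<subseteq> W" using assms subspacesD adjoin_least by metis
  show "card (adjoin U v) = card W"
    using assms by (simp add: subspaces_iff_card card_adjoin)
qed

lemma subspaces_zero:
  fixes V :: "(nat \<Rightarrow> 'a::{field,finite}) set"
  shows "V \<in> subspaces n 0 \<longleftrightarrow> V = {0}"
proof
  assume "V \<in> subspaces n 0"
  then have "card V = 1" "0 \<in> V" by (auto simp: subspaces_iff_card fvec.subspace_0)
  then show "V = {0}" by (metis card_1_singletonE singletonD)
qed (auto simp: subspaces_iff_card fvec.subspace_0 fvec.subspace_single_0 subspace_vecs)

lemma subspaces_top:
  fixes V :: "(nat \<Rightarrow> 'a::{field,finite}) set"
  shows "V \<in> subspaces n n \<longleftrightarrow> V = vecs n"
  using card_subset_eq[OF finite_vecs, of V n]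
  by (auto simp: subspaces_iff_card subspace_vecs card_vecs)

lemma subspaces_proper:
  fixes U :: "(nat \<Rightarrow> 'a::{field,finite}) set"
  assumes "U \<in> subspaces n d" "d < n"
  shows "vecs n - U \<noteq> {}"
proof
  assume "vecs n - U = {}"
  then have "U = vecs n" using assms by (auto simp: subspaces_def)
  then have "CARD('a) ^ d = CARD('a) ^ n"
    using assms(1) by (simp add: subspaces_iff_card card_vecs)
  then show False using assms(2) field_card_gt_one[where 'a = 'a] by simp
qed

section \<open>Flags and the addition of a line\<close>

text \<open>Mirrors the random generation of a flag, so that inductions on it match those on the
  expectation below. Many vectors \<open>v\<close> produce the same flag.\<close>

fun flags_from :: "nat \<Rightarrow> nat \<Rightarrow> (nat \<Rightarrow> 'a::field) set \<Rightarrow> 'a flag set" where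
  "flags_from n 0 U = {[U]}"
| "flags_from n (Suc r) U = (\<Union>v\<in>vecs n - U. (#) U ` flags_from n r (adjoin U v))"

lemma flags_from_Cons: "F \<in> flags_from n r U \<Longrightarrow> \<exists>F'. F = U # F'"
  by (cases r) auto

lemma flags_from_iff:
  fixes U :: "(nat \<Rightarrow> 'a::{field,finite}) set"
  assumes "U \<in> subspaces n d"
  shows "F \<in> flags_from n r U \<longleftrightarrow> length F = Suc r \<and> F ! 0 = U \<and>
    (\<forall>i\<le>r. F ! i \<in> subspaces n (d + i)) \<and> (\<forall>i<r. F ! i \<subseteq> F ! Suc i)"
  using assms
proof (induction r arbitrary: U d F)
  case 0
  then show ?case by (auto simp: length_Suc_conv)
next
  case (Suc r)
  show ?case
  proof
    assume "F \<in> flags_from n (Suc r) U"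
    then obtain v F' where F: "v \<in> vecs n" "v \<notin> U" "F = U # F'" "F' \<in> flags_from n r (adjoin U v)"
      by auto
    with Suc.IH[OF adjoin_in_subspaces[OF Suc.prems F(1,2)]] Suc.prems
    show "length F = Suc (Suc r) \<and> F ! 0 = U \<and>
        (\<forall>i\<le>Suc r. F ! i \<in> subspaces n (d + i)) \<and> (\<forall>i<Suc r. F ! i \<subseteq> F ! Suc i)"
      using subset_adjoin[of U v] by (auto simp: less_Suc_eq_0_disj le_Suc_eq nth_Cons split: nat.split)
  next
    assume R: "length F = Suc (Suc r) \<and> F ! 0 = U \<and>
        (\<forall>i\<le>Suc r. F ! i \<in> subspaces n (d + i)) \<and> (\<forall>i<Suc r. F ! i \<subseteq> F ! Suc i)"
    then obtain F' where F: "F = U # F'" by (cases F) auto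
    have W: "F' ! 0 \<in> subspaces n (Suc d)" "U \<subseteq> F' ! 0"
      using R unfolding F by force+
    have "U \<noteq> F' ! 0"
      using W(1) Suc.prems field_card_gt_one[where 'a = 'a]
      by (metis subspaces_iff_card n_not_Suc_n power_inject_exp)
    then obtain v where v: "v \<in> F' ! 0" "v \<notin> U" using W by blast
    have a: "adjoin U v = F' ! 0" using adjoin_eq_subspace[OF Suc.prems W v] .
    have "F' \<in> flags_from n r (F' ! 0)"
      unfolding Suc.IH[OF W(1)] using R unfolding F by (force simp: Suc_le_eq)
    moreover have "v \<in> vecs n" using v W subspacesD(2) by blast
    ultimately show "F \<in> flags_from n (Suc r) U" using F v a by (auto intro!: bexI[of _ v])
  qed
qed

lemma complete_flags_eq_flags_from:
  "(complete_flags n :: 'a::{field,finite} flag set) = flags_from n n {0}"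
proof -
  have z: "({0} :: (nat \<Rightarrow> 'a) set) \<in> subspaces n 0" by (simp add: subspaces_zero)
  have "F ! 0 = {0}" if "\<forall>i\<le>n. F ! i \<in> subspaces n i" for F :: "'a flag"
    using that by (simp flip: subspaces_zero[of _ n])
  then show ?thesis
    by (intro set_eqI, unfold complete_flags_def flags_from_iff[OF z] mem_Collect_eq add_0) blast
qed

lemma finite_flags_from: "finite (flags_from n r (U :: (nat \<Rightarrow> 'a::{field,finite}) set))"
  by (induction r arbitrary: U) (auto simp: finite_vecs)

lemma finite_complete_flags: "finite (complete_flags n :: 'a::{field,finite} flag set)"
  by (simp add: complete_flags_eq_flags_from finite_flags_from)

section \<open>The effect of one additional vector on a flag\<close>

definition add_vector :: "(nat \<Rightarrow> 'a::field) \<Rightarrow> 'a flag \<Rightarrow> 'a flag" where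
  "add_vector v F = remdups_adj (map (\<lambda>U. adjoin U v) F)"

lemma add_vector_absorb:
  assumes "fvec.subspace U" "v \<in> U" "F \<in> flags_from n r U"
  shows "add_vector v F = F"
  using assms
proof (induction r arbitrary: U F)
  case (Suc r)
  then obtain u F' where F: "u \<in> vecs n" "u \<notin> U" "F = U # F'" "F' \<in> flags_from n r (adjoin U u)"
    by auto
  obtain F'' where F': "F' = adjoin U u # F''" using flags_from_Cons F(4) by blast
  have "adjoin U u \<noteq> U" using F(2) self_in_adjoin[OF Suc.prems(1), of u] by auto
  moreover have v: "v \<in> adjoin U u" using Suc.prems subset_adjoin by blast
  ultimately show ?case
    using Suc.IH[OF _ v F(4)] Suc.prems
    by (simp add: F F' add_vector_def subspace_adjoin adjoin_absorb)
qed (simp add: add_vector_def adjoin_absorb)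

text \<open>The repetition occurs at the first space that contains \<open>v\<close>: there
  \<open>adjoin U v\<close> and \<open>adjoin U u\<close> coincide and everything later is
  unchanged. Before that, \<open>v\<close> passes through to the tail.\<close>

lemma add_vector_Cons:
  assumes "fvec.subspace U" "u \<notin> U" "v \<notin> U" "F \<in> flags_from n r (adjoin U u)"
  shows "add_vector v (U # F) = (if v \<in> adjoin U u then F else adjoin U v # add_vector v F)"
proof -
  obtain F' where F': "F = adjoin U u # F'" using flags_from_Cons assms(4) by blast
  have W: "fvec.subspace (adjoin U u)" using assms(1) by (rule subspace_adjoin)
  show ?thesis
  proof (cases "v \<in> adjoin U u")
    case True
    then have "adjoin U v = adjoin U u" using assms by (simp add: exchange)
    then have "add_vector v (U # F) = add_vector v F"
      using True W by (simp add: F' add_vector_def adjoin_absorb)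
    then show ?thesis using True add_vector_absorb[OF W True assms(4)] by simp
  next
    case False
    \<comment> \<open>If they were equal, \<open>u\<close> would lie in \<open>adjoin U v\<close>,
      and by exchange \<open>v\<close> would lie in \<open>adjoin U u\<close>.\<close>
    have "adjoin U v \<noteq> adjoin (adjoin U u) v"
      using exchange[OF assms(1) _ assms(2), of v] False self_in_adjoin[OF assms(1)]
        subset_adjoin by (metis subsetD)
    then show ?thesis using False by (simp add: F' add_vector_def)
  qed
qed

text \<open>Adjoining \<open>v\<close> to every space turns {0} into the line itself, so the zero
  space has to be put back in front. It differs from the line, hence \<open>remdups_adj\<close> acts
  on the rest alone.\<close>

lemma add_line_span:
  fixes F :: "'a::{field,finite} flag"
  assumes F: "F \<in> complete_flags n" and v: "v \<in> vecs n" "v \<noteq> 0"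
  shows "add_line n F (fvec.span {v}) = {0} # add_vector v F"
proof -
  have n: "n \<noteq> 0" using v by (auto simp: vecs_def fun_eq_iff)
  have sub: "\<And>i. i \<le> n \<Longrightarrow> F ! i \<in> subspaces n i" and len: "length F = Suc n"
    using F by (auto simp: complete_flags_def)
  have F0: "F ! 0 = {0}" using sub[of 0] by (simp add: subspaces_zero)
  have Fn: "adjoin (F ! n) v = F ! n"
    using sub[of n] v by (simp add: subspaces_top adjoin_absorb subspace_vecs)
  have idx: "[0..<Suc n] = 0 # [1..<n] @ [n]" using n by (simp add: upt_conv_Cons)
  have "F = map ((!) F) [0..<Suc n]" using len by (metis map_nth)
  then have "map (\<lambda>U. adjoin U v) F = map (\<lambda>i. adjoin (F ! i) v) [0..<Suc n]"
    by (metis (mono_tags, lifting) comp_apply list.map_comp map_eq_conv)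
  also have "\<dots> = fvec.span {v} # map (\<lambda>i. F ! i + fvec.span {v}) [1..<n] @ [F ! n]"
    unfolding idx using F0 Fn by (simp add: adjoin_zero) (simp add: adjoin_def)
  finally have m: "map (\<lambda>U. adjoin U v) F =
      fvec.span {v} # map (\<lambda>i. F ! i + fvec.span {v}) [1..<n] @ [F ! n]" .
  have "v \<in> fvec.span {v}" by (rule fvec.span_base) simp
  then have "fvec.span {v} \<noteq> {0}" using v(2) by auto
  then show ?thesis by (simp add: add_line_def add_vector_def m F0)
qed

section \<open>The flag spanned by independent random vectors\<close>

locale vector_weighting =
  fixes n :: nat and w :: "(nat \<Rightarrow> 'a::{field,finite}) \<Rightarrow> real"
  assumes weight_pos: "v \<in> vecs n \<Longrightarrow> v \<noteq> 0 \<Longrightarrow> 0 < w v"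
begin

text \<open>The expectation of \<open>h\<close> on the flag generated by independent random vectors: given the
  space \<open>U\<close> reached so far, the next one is \<open>adjoin U v\<close> for \<open>v\<close> drawn outside \<open>U\<close> with
  probability proportional to \<open>w v\<close>.\<close>

fun flag_mean :: "nat \<Rightarrow> (nat \<Rightarrow> 'a) set \<Rightarrow> ('a flag \<Rightarrow> real) \<Rightarrow> real" where
  "flag_mean 0 U h = h [U]"
| "flag_mean (Suc r) U h =
    (\<Sum>v\<in>vecs n - U. w v * flag_mean r (adjoin U v) (\<lambda>F. h (U # F))) / sum w (vecs n - U)"

declare flag_mean.simps(2) [simp del]

lemma flag_mean_cong:
  "(\<And>F. F \<in> flags_from n r U \<Longrightarrow> h F = h' F) \<Longrightarrow> flag_mean r U h = flag_mean r U h'"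
proof (induction r arbitrary: U h h')
  case (Suc r)
  have "flag_mean r (adjoin U v) (\<lambda>F. h (U # F)) = flag_mean r (adjoin U v) (\<lambda>F. h' (U # F))"
    if "v \<in> vecs n - U" for v
    using that by (intro Suc.IH Suc.prems) auto
  then show ?case by (simp add: flag_mean.simps)
qed simp

lemma flag_mean_sum:
  "flag_mean r U (\<lambda>F. \<Sum>G\<in>A. c G * g G F) = (\<Sum>G\<in>A. c G * flag_mean r U (g G))"
proof (induction r arbitrary: U g)
  case (Suc r)
  show ?case
    unfolding flag_mean.simps Suc.IH sum_distrib_left sum_divide_distrib
    by (subst sum.swap) (simp add: algebra_simps)
qed simp

lemma sum_weight_pos:
  assumes "0 \<in> U" "vecs n - U \<noteq> {}"
  shows "0 < sum w (vecs n - U)"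
  using assms by (intro sum_pos) (auto intro!: weight_pos simp: finite_vecs)

lemma flag_mean_const:
  assumes "U \<in> subspaces n d" "d + r \<le> n"
  shows "flag_mean r U (\<lambda>_. c) = c"
  using assms
proof (induction r arbitrary: U d)
  case (Suc r)
  have "flag_mean r (adjoin U v) (\<lambda>_. c) = c" if "v \<in> vecs n - U" for v
    using that Suc.prems by (intro Suc.IH[of _ "Suc d"] adjoin_in_subspaces) auto
  then have "flag_mean (Suc r) U (\<lambda>_. c) = sum w (vecs n - U) * c / sum w (vecs n - U)"
    by (simp add: flag_mean.simps sum_distrib_right)
  moreover have "0 < sum w (vecs n - U)"
    using Suc.prems subspaces_proper[OF Suc.prems(1)]
    by (intro sum_weight_pos) (auto intro: subspacesD)
  ultimately show ?case by simp
qed simp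

text \<open>A vector \<open>v\<close> outside \<open>U\<close> may be added before or after the random vectors are drawn:
  the first of these that falls into \<open>adjoin U v\<close> outside \<open>U\<close> spans the same space with \<open>U\<close>.\<close>

lemma flag_mean_add_vector:
  assumes "U \<in> subspaces n d" "Suc d + r = n" "v \<in> vecs n" "v \<notin> U"
  shows "flag_mean (Suc r) U (\<lambda>F. h (add_vector v F)) = flag_mean r (adjoin U v) h"
  using assms
proof (induction r arbitrary: U d h)
  case 0
  have U: "fvec.subspace U" using 0 subspacesD by blast
  have "add_vector v [U, adjoin U u] = [adjoin U v]" if "u \<in> vecs n - U" for u
  proof -
    have "adjoin U u \<in> subspaces n n"
      using adjoin_in_subspaces[OF 0(1), of u] that 0(2) by auto
    then have "v \<in> adjoin U u" using 0(3) by (simp add: subspaces_top)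
    then show ?thesis
      using add_vector_Cons[OF U, of u v "[adjoin U u]" n 0] that 0 exchange[OF U] by simp
  qed
  moreover have "0 < sum w (vecs n - U)"
    using 0 by (intro sum_weight_pos) (auto intro: subspacesD)
  ultimately show ?case by (simp add: flag_mean.simps(2) flip: sum_distrib_right)
next
  case (Suc r)
  let ?W = "adjoin U v"
  let ?m = "flag_mean (Suc r) ?W h"
  have U: "fvec.subspace U" and W: "fvec.subspace ?W"
    using subspacesD(1)[OF Suc.prems(1)] by (auto intro: subspace_adjoin)
  have W': "?W \<in> subspaces n (Suc d)" using Suc.prems by (simp add: adjoin_in_subspaces)
  have UW: "U \<subseteq> ?W" "?W \<subseteq> vecs n" using subset_adjoin subspacesD(2)[OF W'] by auto
  have pos: "0 < sum w (vecs n - U)" "0 < sum w (vecs n - ?W)"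
    using Suc.prems subspaces_proper[OF W'] subspacesD(3)[OF W'] subspacesD(3)[OF Suc.prems(1)]
    by (intro sum_weight_pos; force)+
  let ?t = "\<lambda>u. flag_mean (Suc r) (adjoin U u) (\<lambda>F. h (add_vector v (U # F)))"
  \<comment> \<open>The drawn \<open>u\<close> already spans \<open>?W\<close> with
    \<open>U\<close>, so adding \<open>v\<close> merely drops \<open>U\<close> from the
    list.\<close>
  have inside: "?t u = ?m" if "u \<in> ?W - U" for u
  proof -
    have eq: "adjoin U u = ?W" using that exchange[OF U] by blast
    have v: "v \<in> adjoin U u" unfolding eq using U by (rule self_in_adjoin)
    have "?t u = flag_mean (Suc r) (adjoin U u) h"
      using that Suc.prems v by (intro flag_mean_cong) (auto simp: add_vector_Cons[OF U] simp del: flags_from.simps)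
    then show ?thesis using eq by simp
  qed
  \<comment> \<open>Here \<open>v\<close> is still outside \<open>adjoin U u\<close>; the induction
    hypothesis moves it past the remaining draws, after which \<open>u\<close> acts as a draw made
    from \<open>?W\<close>.\<close>
  have outside: "?t u = flag_mean r (adjoin ?W u) (\<lambda>F. h (?W # F))" if "u \<in> vecs n - ?W" for u
  proof -
    have u: "u \<notin> U" "u \<in> vecs n" using that UW by blast+
    have v: "v \<notin> adjoin U u"
      using exchange[OF U, of v u] Suc.prems(4) that self_in_adjoin[OF U, of u] by auto
    have "?t u = flag_mean (Suc r) (adjoin U u) (\<lambda>F. h (?W # add_vector v F))"
      using u v Suc.prems by (intro flag_mean_cong) (auto simp: add_vector_Cons[OF U] simp del: flags_from.simps)
    also have "\<dots> = flag_mean r (adjoin (adjoin U u) v) (\<lambda>F. h (?W # F))"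
      using Suc.prems u v by (intro Suc.IH[of _ "Suc d"] adjoin_in_subspaces) auto
    finally show ?thesis by (simp add: adjoin_commute[of U u])
  qed
  have split: "vecs n - U = (?W - U) \<union> (vecs n - ?W)" and disj: "(?W - U) \<inter> (vecs n - ?W) = {}"
    using UW by blast+
  have fin: "finite (?W - U)" "finite (vecs n - ?W)"
    using finite_subset[OF UW(2) finite_vecs] finite_vecs by auto
  \<comment> \<open>Both groups have mean \<open>?m\<close>: the first one termwise, the second
    because it is the recursion defining \<open>?m\<close>, cleared of its denominator. Hence so
    does their union.\<close>
  have "(\<Sum>u\<in>vecs n - U. w u * ?t u) =
      (\<Sum>u\<in>?W - U. w u * ?m) + (\<Sum>u\<in>vecs n - ?W. w u * flag_mean r (adjoin ?W u) (\<lambda>F. h (?W # F)))"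
    unfolding split using inside outside fin disj by (simp add: sum.union_disjoint)
  also have "(\<Sum>u\<in>?W - U. w u * ?m) = sum w (?W - U) * ?m"
    by (simp add: sum_distrib_right)
  also have "(\<Sum>u\<in>vecs n - ?W. w u * flag_mean r (adjoin ?W u) (\<lambda>F. h (?W # F))) =
      sum w (vecs n - ?W) * ?m"
    using pos by (simp add: flag_mean.simps(2)[of r])
  also have "sum w (?W - U) * ?m + sum w (vecs n - ?W) * ?m = sum w (vecs n - U) * ?m"
    unfolding split using fin disj by (simp add: sum.union_disjoint distrib_right)
  finally have "(\<Sum>u\<in>vecs n - U. w u * ?t u) = sum w (vecs n - U) * ?m" .
  then show ?case using pos by (simp add: flag_mean.simps(2)[of "Suc r" U])
qed

text \<open>By exchange, exactly the vectors of \<open>F ! Suc k - F ! k\<close> extend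
  \<open>F ! k\<close> to \<open>F ! Suc k\<close>, so each step has a quotient of weights as its
  conditional probability.\<close>

lemma flag_mean_indicator:
  assumes "F \<in> flags_from n r U" "U \<in> subspaces n d"
  shows "flag_mean r U (\<lambda>G. of_bool (G = F)) =
    (\<Prod>k<r. sum w (F ! Suc k - F ! k) / sum w (vecs n - F ! k))"
  using assms
proof (induction r arbitrary: U d F)
  case (Suc r)
  then obtain u F' where F: "u \<in> vecs n" "u \<notin> U" "F = U # F'" "F' \<in> flags_from n r (adjoin U u)"
    by auto
  have U: "fvec.subspace U" using Suc.prems subspacesD by blast
  obtain F'' where F': "F' = adjoin U u # F''" using flags_from_Cons F(4) by blast
  let ?p = "flag_mean r (adjoin U u) (\<lambda>G. of_bool (G = F'))"
  have W: "adjoin U u \<in> subspaces n (Suc d)" using Suc.prems F by (simp add: adjoin_in_subspaces)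
  have "w v * flag_mean r (adjoin U v) (\<lambda>G. of_bool (U # G = F)) =
      (if v \<in> adjoin U u then w v * ?p else 0)" if v: "v \<in> vecs n - U" for v
  proof (cases "v \<in> adjoin U u")
    case True
    then have "adjoin U v = adjoin U u" using v exchange[OF U] by auto
    then show ?thesis using True F(3) by simp
  next
    case False
    then have ne: "adjoin U v \<noteq> adjoin U u" using self_in_adjoin[OF U] by metis
    have "flag_mean r (adjoin U v) (\<lambda>G. of_bool (U # G = F)) = flag_mean r (adjoin U v) (\<lambda>_. 0)"
      using flags_from_Cons ne F(3) F' by (intro flag_mean_cong) fastforce
    \<comment> \<open>Linearity over an empty index set yields the mean 0 without any bound on the
      dimension.\<close>
    also have "\<dots> = 0"
      using flag_mean_sum[where A = "{}"] by simp
    finally show ?thesis using False by simp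
  qed
  then have "flag_mean (Suc r) U (\<lambda>G. of_bool (G = F)) =
      (\<Sum>v\<in>vecs n - U. if v \<in> adjoin U u then w v * ?p else 0) / sum w (vecs n - U)"
    by (simp add: flag_mean.simps(2))
  also have "(\<Sum>v\<in>vecs n - U. if v \<in> adjoin U u then w v * ?p else 0) =
      (\<Sum>v\<in>adjoin U u - U. w v * ?p)"
    using subspacesD(2)[OF W] by (intro sum.mono_neutral_cong_right) (auto simp: finite_vecs)
  finally show ?case
    using Suc.IH[OF F(4) W]
    by (simp add: prod.lessThan_Suc_shift F(3) F' flip: sum_distrib_right del: prod.lessThan_Suc)
qed simp

end

text \<open>The last space of \<open>F\<close> is all of \<open>vecs n\<close> and contains
  \<open>v\<close>, so exactly one repetition arises and the list gets shorter by one. The case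
  split is that of \<open>flag_mean_add_vector\<close>.\<close>

lemma add_vector_in_flags_from:
  fixes U :: "(nat \<Rightarrow> 'a::{field,finite}) set"
  assumes "U \<in> subspaces n d" "Suc d + r = n" "v \<in> vecs n" "v \<notin> U" "F \<in> flags_from n (Suc r) U"
  shows "add_vector v F \<in> flags_from n r (adjoin U v)"
  using assms
proof (induction r arbitrary: U d F)
  case (0 U d F)
  then obtain u where F: "u \<in> vecs n" "u \<notin> U" "F = [U, adjoin U u]" by auto
  have U: "fvec.subspace U" using 0 subspacesD by blast
  have "adjoin U u = vecs n"
    using adjoin_in_subspaces[OF 0(1) F(1,2)] 0(2) by (simp add: subspaces_top)
  then show ?case
    using add_vector_Cons[OF U F(2), of v "[adjoin U u]" n 0] 0 F exchange[OF U, of v u] by simp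
next
  case (Suc r)
  then obtain u F' where F: "u \<in> vecs n" "u \<notin> U" "F = U # F'"
      "F' \<in> flags_from n (Suc r) (adjoin U u)"
    by (auto simp del: flags_from.simps simp: flags_from.simps(2)[of n "Suc r" U])
  have U: "fvec.subspace U" using Suc.prems subspacesD by blast
  note step = add_vector_Cons[OF U F(2) Suc.prems(4) F(4)]
  show ?case
  proof (cases "v \<in> adjoin U u")
    case True
    then show ?thesis using step F exchange[OF U True] Suc.prems by simp
  next
    case False
    have "add_vector v F' \<in> flags_from n r (adjoin (adjoin U u) v)"
      using Suc.prems F False
      by (intro Suc.IH[of _ "Suc d"] adjoin_in_subspaces) auto
    \<comment> \<open>This makes \<open>u\<close> an admissible next generator after
      \<open>adjoin U v\<close>; exchange turns it into the assumption on \<open>v\<close>.\<close>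
    moreover have "u \<notin> adjoin U v"
      using exchange[OF U _ F(2)] False self_in_adjoin[OF U] by metis
    ultimately show ?thesis using step F False
      by (auto simp: adjoin_commute[of U u])
  qed
qed

lemma add_vector_in_complete_flags:
  fixes F :: "'a::{field,finite} flag"
  assumes "F \<in> complete_flags n" "v \<in> vecs n" "v \<noteq> 0"
  shows "{0} # add_vector v F \<in> complete_flags n"
proof (cases n)
  case 0
  then show ?thesis using assms by (auto simp: vecs_def fun_eq_iff)
next
  case (Suc m)
  then have "add_vector v F \<in> flags_from n m (adjoin {0} v)"
    using assms by (intro add_vector_in_flags_from[of _ _ 0])
      (auto simp: subspaces_zero complete_flags_eq_flags_from simp del: flags_from.simps)
  then show ?thesis
    using assms Suc by (auto simp: complete_flags_eq_flags_from intro!: bexI[of _ v])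
qed

text \<open>No repetition arises before \<open>v\<close> is first contained in a space, so up to
  there the entries keep their positions.\<close>

lemma add_vector_nth:
  assumes "fvec.subspace U" "F \<in> flags_from n r U" "\<forall>i\<le>j. v \<notin> F ! i" "j \<le> r"
  shows "add_vector v F ! j = adjoin (F ! j) v"
  using assms
proof (induction r arbitrary: U F j)
  case (Suc r)
  then obtain u F' where F: "u \<notin> U" "F = U # F'" "F' \<in> flags_from n r (adjoin U u)" by auto
  obtain F'' where F': "F' = adjoin U u # F''" using flags_from_Cons F(3) by blast
  have v: "v \<notin> U" using Suc.prems F by force
  note step = add_vector_Cons[OF Suc.prems(1) F(1) v F(3)]
  show ?case
  proof (cases j)
    case 0
    then show ?thesis using step F F' v exchange[OF Suc.prems(1)] by simp
  next
    case (Suc i)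
    then have "\<forall>k\<le>i. v \<notin> F' ! k" using Suc.prems(3) F(2) by force
    moreover from this have "v \<notin> adjoin U u" using F' by force
    ultimately show ?thesis
      using Suc step F Suc.prems Suc.IH[OF subspace_adjoin[OF Suc.prems(1)] F(3), of i] by simp
  qed
qed (simp add: add_vector_def)

section \<open>The stationary distribution\<close>

text \<open>The positive and negative parts of the difference of two fixed vectors are fixed themselves;
  if both are nonzero, both are positive at the state \<open>g\<close>.\<close>

lemma fixed_vector_unique:
  fixes P :: "'b \<Rightarrow> 'b \<Rightarrow> real" and \<Phi> \<Phi>' :: "'b \<Rightarrow> real"
  assumes A: "finite A"
    and P: "\<And>F G. F \<in> A \<Longrightarrow> G \<in> A \<Longrightarrow> 0 \<le> P F G" "\<And>F. F \<in> A \<Longrightarrow> (\<Sum>G\<in>A. P F G) = 1"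
    and reach: "\<And>E F. \<lbrakk>\<And>G. G \<in> A \<Longrightarrow> 0 \<le> E G; \<And>G. G \<in> A \<Longrightarrow> (\<Sum>F\<in>A. E F * P F G) = E G;
        F \<in> A; 0 < E F\<rbrakk> \<Longrightarrow> 0 < E g"
    and fixed: "\<And>G. G \<in> A \<Longrightarrow> (\<Sum>F\<in>A. \<Phi> F * P F G) = \<Phi> G"
      "\<And>G. G \<in> A \<Longrightarrow> (\<Sum>F\<in>A. \<Phi>' F * P F G) = \<Phi>' G"
    and total: "sum \<Phi> A = sum \<Phi>' A"
    and F: "F \<in> A"
  shows "\<Phi> F = \<Phi>' F"
proof -
  define D where "D F = \<Phi> F - \<Phi>' F" for F
  have D: "(\<Sum>F\<in>A. D F * P F G) = D G" if "G \<in> A" for G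
    using fixed that by (simp add: D_def left_diff_distrib sum_subtractf)
  have le: "0 \<le> (\<Sum>F\<in>A. \<bar>D F\<bar> * P F G) - \<bar>D G\<bar>" if "G \<in> A" for G
  proof -
    have "\<bar>D G\<bar> = \<bar>\<Sum>F\<in>A. D F * P F G\<bar>" using D that by simp
    also have "\<dots> \<le> (\<Sum>F\<in>A. \<bar>D F * P F G\<bar>)" by (rule sum_abs)
    also have "\<dots> = (\<Sum>F\<in>A. \<bar>D F\<bar> * P F G)" using P(1) that by (simp add: abs_mult)
    finally show ?thesis by simp
  qed
  have "(\<Sum>G\<in>A. (\<Sum>F\<in>A. \<bar>D F\<bar> * P F G) - \<bar>D G\<bar>) = (\<Sum>F\<in>A. \<bar>D F\<bar> * (\<Sum>G\<in>A. P F G)) - (\<Sum>G\<in>A. \<bar>D G\<bar>)"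
    by (subst sum_subtractf, subst sum.swap) (simp add: sum_distrib_left)
  also have "\<dots> = 0" using P(2) by simp
  \<comment> \<open>The triangle inequality holds at every state, and both sides have the same total
    because the rows of \<open>P\<close> sum to 1; so it is an equality everywhere.\<close>
  finally have abs: "(\<Sum>F\<in>A. \<bar>D F\<bar> * P F G) = \<bar>D G\<bar>" if "G \<in> A" for G
    using sum_nonneg_eq_0_iff[OF A le] that by simp
  have zero: "sum D A = 0" using total by (simp add: D_def sum_subtractf)
  \<comment> \<open>\<open>\<bar>D F\<bar> + D F\<close> is twice the positive part of
    \<open>D\<close>, and fixed by \<open>D\<close> and \<open>abs\<close>.\<close>
  have pos: "0 < \<bar>D g\<bar> + D g" if "F \<in> A" "0 < D F" for F
    using that D abs by (intro reach[of "\<lambda>F. \<bar>D F\<bar> + D F" F]) (auto simp: distrib_right sum.distrib)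
  have neg: "0 < \<bar>D g\<bar> - D g" if "F \<in> A" "D F < 0" for F
    using that D abs
    by (intro reach[of "\<lambda>F. \<bar>D F\<bar> - D F" F]) (auto simp: left_diff_distrib sum_subtractf)
  \<comment> \<open>Values of both signs would give \<open>\<bar>D g\<bar> + D g\<close> and
    \<open>\<bar>D g\<bar> - D g\<close> both positive, which is impossible for one real
    number.\<close>
  have "(\<forall>F\<in>A. 0 \<le> D F) \<or> (\<forall>F\<in>A. 0 \<le> - D F)"
    using pos neg by (smt (verit))
  then have "D F = 0"
  proof
    assume "\<forall>F\<in>A. 0 \<le> D F"
    then show ?thesis using sum_nonneg_eq_0_iff[OF A, of D] zero F by simp
  next
    assume "\<forall>F\<in>A. 0 \<le> - D F"
    then show ?thesis using sum_nonneg_eq_0_iff[OF A, of "\<lambda>F. - D F"] zero F by (simp add: sum_negf)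
  qed
  then show ?thesis by (simp add: D_def)
qed

locale probability_weighting = vector_weighting +
  assumes dim_pos: "0 < n" and total_weight: "sum w (vecs n - {0}) = 1"
begin

definition flag_prob :: "'a flag \<Rightarrow> real" where
  "flag_prob G = flag_mean n {0} (\<lambda>F. of_bool (F = G))"

definition transition :: "'a flag \<Rightarrow> 'a flag \<Rightarrow> real" where
  "transition F G = (\<Sum>v\<in>vecs n - {0}. w v * of_bool ({0} # add_vector v F = G))"

lemma flag_mean_eq_sum: "(\<Sum>F\<in>complete_flags n. flag_prob F * h F) = flag_mean n {0} h"
proof -
  have "flag_mean n {0} h =
      flag_mean n {0} (\<lambda>F. \<Sum>G\<in>complete_flags n. h G * of_bool (F = G))"
    by (intro flag_mean_cong)
      (simp add: finite_flags_from complete_flags_eq_flags_from of_bool_def if_distrib sum.delta cong: if_cong)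
  then show ?thesis by (simp add: flag_mean_sum flag_prob_def mult.commute)
qed

lemma sum_flag_prob: "sum flag_prob (complete_flags n) = 1"
  using flag_mean_eq_sum[of "\<lambda>_. 1"] flag_mean_const[of "{0}" 0 n] by (simp add: subspaces_zero)

lemma flag_prob_outside: "G \<notin> complete_flags n \<Longrightarrow> flag_prob G = 0"
proof -
  assume "G \<notin> complete_flags n"
  then have "flag_prob G = flag_mean n {0} (\<lambda>_. 0)"
    unfolding flag_prob_def by (intro flag_mean_cong) (auto simp: complete_flags_eq_flags_from)
  then show ?thesis using flag_mean_const[of "{0}" 0 n] by (simp add: subspaces_zero)
qed

lemma flag_prob_eq_prod:
  assumes "F \<in> complete_flags n"
  shows "flag_prob F = (\<Prod>k<n. sum w (F ! Suc k - F ! k) / sum w (vecs n - F ! k))"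
  unfolding flag_prob_def using assms
  by (intro flag_mean_indicator[where d = 0]) (simp_all add: complete_flags_eq_flags_from subspaces_zero)

lemma flag_prob_nonneg:
  assumes "F \<in> complete_flags n"
  shows "0 \<le> flag_prob F"
proof -
  have "v \<in> vecs n \<and> v \<noteq> 0" if "k < n" "v \<in> (F ! Suc k - F ! k) \<union> (vecs n - F ! k)" for k v
  proof -
    have "F ! Suc k \<in> subspaces n (Suc k)" "F ! k \<in> subspaces n k"
      using assms that(1) by (auto simp: complete_flags_def)
    then show ?thesis using that(2) subspacesD(2,3) by blast
  qed
  then show ?thesis
    unfolding flag_prob_eq_prod[OF assms]
    by (intro prod_nonneg divide_nonneg_nonneg sum_nonneg less_imp_le weight_pos ballI) auto
qed

text \<open>For fixed \<open>v\<close>, \<open>flag_mean_add_vector\<close> at {0} makes the inner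
  mean the one started from the line of \<open>v\<close>. Averaging over \<open>v\<close> is then
  the first step of the recursion for \<open>flag_prob\<close>, whose denominator is the total
  weight 1.\<close>

lemma flag_prob_stationary: "(\<Sum>F\<in>complete_flags n. flag_prob F * transition F G) = flag_prob G"
proof -
  let ?h = "\<lambda>F. of_bool ({0} # F = G) :: real"
  obtain m where m: "n = Suc m" using dim_pos gr0_implies_Suc by blast
  have "(\<Sum>F\<in>complete_flags n. flag_prob F * transition F G) =
      (\<Sum>v\<in>vecs n - {0}. w v * (\<Sum>F\<in>complete_flags n. flag_prob F * ?h (add_vector v F)))"
    unfolding transition_def sum_distrib_left by (subst sum.swap) (simp add: ac_simps)
  also have "\<dots> = (\<Sum>v\<in>vecs n - {0}. w v * flag_mean m (adjoin {0} v) ?h)"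
    unfolding flag_mean_eq_sum using m flag_mean_add_vector[of "{0}" 0 m _ ?h]
    by (intro sum.cong) (auto simp: subspaces_zero)
  also have "\<dots> = flag_mean (Suc m) {0} (\<lambda>F. of_bool (F = G))"
    by (simp add: flag_mean.simps(2) total_weight)
  finally show ?thesis by (simp add: flag_prob_def m[symmetric])
qed

lemma transition_nonneg: "0 \<le> transition F G"
  unfolding transition_def by (intro sum_nonneg mult_nonneg_nonneg less_imp_le[OF weight_pos]) auto

lemma sum_transition:
  assumes "F \<in> complete_flags n"
  shows "(\<Sum>G\<in>complete_flags n. transition F G) = 1"
proof -
  have "(\<Sum>G\<in>complete_flags n. transition F G) = (\<Sum>v\<in>vecs n - {0}. w v *
      (\<Sum>G\<in>complete_flags n. of_bool ({0} # add_vector v F = G)))"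
    unfolding transition_def sum_distrib_left by (rule sum.swap)
  also have "\<dots> = sum w (vecs n - {0})"
    using add_vector_in_complete_flags[OF assms]
    by (intro sum.cong) (auto simp: finite_complete_flags of_bool_def sum.delta)
  finally show ?thesis by (simp add: total_weight)
qed

lemma transition_add_vector:
  assumes "v \<in> vecs n" "v \<noteq> 0"
  shows "w v \<le> transition F ({0} # add_vector v F)"
proof -
  have "w v * of_bool ({0} # add_vector v F = {0} # add_vector v F) \<le> transition F ({0} # add_vector v F)"
    unfolding transition_def using assms
    by (intro member_le_sum) (auto simp: finite_vecs intro: less_imp_le[OF weight_pos])
  then show ?thesis by simp
qed

definition standard_flag :: "'a flag" where
  "standard_flag = map (\<lambda>j. coord_space {0<..j}) [0..<Suc n]"

text \<open>Adding the basis vectors \<open>n, \<dots>, 1\<close> in this order leads from any flag to the standard one.\<close>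

lemma standard_flag_reached:
  assumes nonneg: "\<And>G. G \<in> complete_flags n \<Longrightarrow> 0 \<le> E G"
    and fixed: "\<And>G. G \<in> complete_flags n \<Longrightarrow> (\<Sum>F\<in>complete_flags n. E F * transition F G) = E G"
    and F: "F \<in> complete_flags n" "0 < E F"
  shows "0 < E standard_flag"
proof -
  have step: "0 < E ({0} # add_vector v F)"
    if "F \<in> complete_flags n" "0 < E F" "v \<in> vecs n" "v \<noteq> 0" for F v
  proof -
    let ?G = "{0} # add_vector v F"
    have "0 < E F * transition F ?G"
      using that weight_pos transition_add_vector by (smt (verit) mult_pos_pos)
    also have "\<dots> \<le> (\<Sum>F\<in>complete_flags n. E F * transition F ?G)"
      using that nonneg transition_nonneg
      by (intro member_le_sum) (auto simp: finite_complete_flags)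
    finally show ?thesis using fixed add_vector_in_complete_flags that by metis
  qed
  \<comment> \<open>Invariant after adding the last \<open>k\<close> basis vectors: only the first
    \<open>k + 1\<close> spaces are controlled, and the most recently added vector spans the line of
    the flag.\<close>
  have "\<exists>F\<in>complete_flags n. 0 < E F \<and> (\<forall>j\<le>k. F ! j = coord_space {n - k<..n - k + j})"
    if "k \<le> n" for k
    using that
  proof (induction k)
    case 0
    have "F ! 0 = {0}" using F(1) by (auto simp: complete_flags_def subspaces_zero[of _ n, symmetric])
    then show ?case using F by (auto simp: coord_space_empty intro!: bexI[of _ F])
  next
    case (Suc k)
    then obtain F where F: "F \<in> complete_flags n" "0 < E F"
        "\<And>j. j \<le> k \<Longrightarrow> F ! j = coord_space {n - k<..n - k + j}"
      by auto
    define v :: "nat \<Rightarrow> 'a" where "v = basis_vec (n - k)"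
    have "v (n - k) \<noteq> 0" by (simp add: v_def basis_vec_def)
    then have v: "v \<in> vecs n" "v \<noteq> 0"
      using Suc.prems by (auto simp: v_def vecs_eq_coord_space basis_vec_in_coord_space)
    have "({0} # add_vector v F) ! j = coord_space {n - Suc k<..n - Suc k + j}" if "j \<le> Suc k" for j
    proof (cases j)
      case 0
      then show ?thesis by (simp add: coord_space_empty)
    next
      case j: (Suc i)
      \<comment> \<open>The controlled spaces involve only coordinates above \<open>n - k\<close>,
        so none contains \<open>v\<close>: each is enlarged by \<open>v\<close> and, with {0} in
        front, moves up by one position.\<close>
      then have "add_vector v F ! i = adjoin (F ! i) v"
        using F(1,3) that Suc.prems
        by (intro add_vector_nth[of "{0}" _ n n])
          (auto simp: complete_flags_eq_flags_from v_def basis_vec_in_coord_space)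
      also have "\<dots> = coord_space (insert (n - k) {n - k<..n - k + i})"
        using F(3)[of i] that j by (simp add: v_def coord_space_insert)
      also have "insert (n - k) {n - k<..n - k + i} = {n - Suc k<..n - Suc k + j}"
        using Suc.prems j by auto
      finally show ?thesis using j by simp
    qed
    then show ?case
      using step[OF F(1,2) v] add_vector_in_complete_flags[OF F(1) v] by blast
  qed
  from this[of n] obtain G where G: "G \<in> complete_flags n" "0 < E G"
    "\<forall>j\<le>n. G ! j = coord_space {0<..j}" by auto
  then have "G = standard_flag"
    by (intro nth_equalityI) (auto simp: standard_flag_def complete_flags_def simp del: upt_Suc)
  then show ?thesis using G by simp
qed

lemma flag_prob_unique:
  assumes "\<And>G. G \<in> complete_flags n \<Longrightarrow> (\<Sum>F\<in>complete_flags n. \<Phi> F * transition F G) = \<Phi> G"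
    and "sum \<Phi> (complete_flags n) = 1" and "F \<in> complete_flags n"
  shows "\<Phi> F = flag_prob F"
  by (rule fixed_vector_unique[OF finite_complete_flags transition_nonneg sum_transition
        standard_flag_reached assms(1) flag_prob_stationary])
    (assumption | simp add: assms sum_flag_prob)+

text \<open>The product formula sees only weights of set differences, and an injective
  weight-preserving map respects these. It is applied to lower triangular matrices.\<close>

lemma flag_prob_map:
  assumes F: "F \<in> complete_flags n" "map ((`) \<beta>) F \<in> complete_flags n"
    and \<beta>: "bij_betw \<beta> (vecs n) (vecs n)" "\<And>v. v \<in> vecs n \<Longrightarrow> w (\<beta> v) = w v"
  shows "flag_prob (map ((`) \<beta>) F) = flag_prob F"
proof -
  have sum_image: "sum w (\<beta> ` W - \<beta> ` V) = sum w (W - V)" if "V \<subseteq> vecs n" "W \<subseteq> vecs n" for V W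
  proof -
    have inj: "inj_on \<beta> (vecs n)" using \<beta>(1) by (simp add: bij_betw_def)
    have "\<beta> ` W - \<beta> ` V = \<beta> ` (W - V)"
      using inj that by (auto simp: inj_on_def)
    moreover have "inj_on \<beta> (W - V)" using inj that by (auto intro: inj_on_subset)
    ultimately show ?thesis using \<beta>(2) that by (auto simp: sum.reindex intro!: sum.cong)
  qed
  have sub: "F ! k \<subseteq> vecs n" "k < length F" if "k \<le> n" for k
    using F(1) that by (auto simp: complete_flags_def subspaces_def)
  have vecs: "vecs n = \<beta> ` vecs n" using \<beta>(1) by (simp add: bij_betw_def)
  have "sum w (vecs n - \<beta> ` (F ! k)) = sum w (vecs n - F ! k)" if "k < n" for k
    using sum_image[of "F ! k" "vecs n"] sub[of k] vecs that by simp
  moreover have "sum w (\<beta> ` (F ! Suc k) - \<beta> ` (F ! k)) = sum w (F ! Suc k - F ! k)" if "k < n" for k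
    using sum_image sub that by simp
  ultimately show ?thesis
    unfolding flag_prob_eq_prod[OF F(1)] flag_prob_eq_prod[OF F(2)]
    using sub by (intro prod.cong) auto
qed

end

section \<open>Lines and leading indices\<close>

text \<open>The pivot position: constant on the nonzero vectors of a line, and equal to the index of
  its normal form.\<close>

definition lead :: "(nat \<Rightarrow> 'a::field) \<Rightarrow> nat" where
  "lead v = (LEAST i. v i \<noteq> 0)"

lemma lead_eqI: "v i \<noteq> 0 \<Longrightarrow> (\<And>j. j < i \<Longrightarrow> v j = 0) \<Longrightarrow> lead v = i"
  unfolding lead_def by (rule Least_equality) (auto simp: not_less[symmetric])

lemma lead_nonzero: "v \<noteq> 0 \<Longrightarrow> v (lead v) \<noteq> 0"
  unfolding lead_def by (rule LeastI_ex) (auto simp: fun_eq_iff)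

lemma less_lead: "j < lead v \<Longrightarrow> v j = 0"
  unfolding lead_def using not_less_Least by blast

lemma lead_vscale: "c \<noteq> 0 \<Longrightarrow> lead (vscale c v) = lead v"
  by (simp add: lead_def vscale_def)

lemma lead_in_vecs: "v \<in> vecs n \<Longrightarrow> v \<noteq> 0 \<Longrightarrow> lead v \<in> {1..n}"
  using lead_nonzero[of v] by (auto simp: vecs_def)

lemma sum_fun_apply: "sum f A j = (\<Sum>k\<in>A. f k j)"
  by (induction A rule: infinite_finite_induct) auto

lemma monic_vector_apply:
  "(basis_vec i + (\<Sum>k\<in>{i<..n}. vscale (c k) (basis_vec k))) j =
    (if j = i then 1 else if j \<in> {i<..n} then c j else (0 :: 'a::field))"
proof -
  have "(\<Sum>k\<in>{i<..n}. vscale (c k) (basis_vec k)) j = (\<Sum>k\<in>{i<..n}. if k = j then c k else 0)"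
    unfolding sum_fun_apply by (intro sum.cong) (auto simp: vscale_def basis_vec_def)
  then show ?thesis by (auto simp: basis_vec_def)
qed

lemma span_vscale: "c \<noteq> 0 \<Longrightarrow> fvec.span {vscale c v} = fvec.span {v :: nat \<Rightarrow> 'a::field}"
  using exchange[OF fvec.subspace_single_0, of "vscale c v" v]
  by (cases "v = 0") (auto simp: adjoin_zero fvec.span_singleton)

text \<open>Dividing by the pivot entry gives the normal form. Its index is unique because scaling
  preserves the pivot and the normal form with index \<open>i\<close> has pivot
  \<open>i\<close>.\<close>

lemma line_index_span:
  fixes v :: "nat \<Rightarrow> 'a::field"
  assumes v: "v \<in> vecs n" "v \<noteq> 0"
  shows "line_index n (fvec.span {v}) = lead v"
  unfolding line_index_def
proof (rule the_equality)
  let ?c = "1 / v (lead v)"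
  have nz: "v (lead v) \<noteq> 0" using v(2) by (rule lead_nonzero)
  have "basis_vec (lead v) + (\<Sum>k\<in>{lead v<..n}. vscale (vscale ?c v k) (basis_vec k)) = vscale ?c v"
    unfolding fun_eq_iff monic_vector_apply
    using v(1) nz less_lead[of _ v] by (auto simp: vscale_def vecs_def not_less not_le)
  then have "fvec.span {v} = fvec.span {basis_vec (lead v) +
      (\<Sum>k\<in>{lead v<..n}. vscale (vscale ?c v k) (basis_vec k))}"
    using nz by (simp add: span_vscale)
  then show "lead v \<in> {1..n} \<and> (\<exists>c. fvec.span {v} =
      fvec.span {basis_vec (lead v) + (\<Sum>k\<in>{lead v<..n}. vscale (c k) (basis_vec k))})"
    using lead_in_vecs[OF v] by blast
next
  fix i
  assume "i \<in> {1..n} \<and> (\<exists>c. fvec.span {v} =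
      fvec.span {basis_vec i + (\<Sum>k\<in>{i<..n}. vscale (c k) (basis_vec k))})"
  then obtain c where c: "fvec.span {v} =
      fvec.span {basis_vec i + (\<Sum>k\<in>{i<..n}. vscale (c k) (basis_vec k))}" by blast
  let ?u = "basis_vec i + (\<Sum>k\<in>{i<..n}. vscale (c k) (basis_vec k))"
  have "v \<in> fvec.span {?u}" unfolding c[symmetric] by (rule fvec.span_base) simp
  then obtain a where a: "v = vscale a ?u" by (auto simp: fvec.span_singleton)
  then have "lead v = lead ?u" using v(2) lead_vscale[of a ?u] by auto
  also have "\<dots> = i" by (rule lead_eqI) (auto simp: monic_vector_apply simp del: plus_fun_apply)
  finally show "i = lead v" by simp
qed

lemma span_line:
  fixes L :: "(nat \<Rightarrow> 'a::{field,finite}) set"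
  assumes "L \<in> subspaces n 1" "v \<in> L" "v \<noteq> 0"
  shows "fvec.span {v} = L"
  using adjoin_eq_subspace[of "{0}" n 0 L v] assms subspacesD[OF assms(1)]
  by (simp add: adjoin_zero subspaces_zero)

lemma span_in_lines:
  fixes v :: "nat \<Rightarrow> 'a::{field,finite}"
  assumes "v \<in> vecs n" "v \<noteq> 0"
  shows "fvec.span {v} \<in> subspaces n 1"
  using adjoin_in_subspaces[of "{0}" n 0 v] assms by (simp add: adjoin_zero subspaces_zero)

section \<open>Weights of vectors and of coordinate spaces\<close>

definition vec_weight :: "nat \<Rightarrow> (nat \<Rightarrow> real) \<Rightarrow> (nat \<Rightarrow> 'a::{field,finite}) \<Rightarrow> real" where
  "vec_weight n x v = x (lead v) / (real CARD('a) ^ (n - lead v) * (real CARD('a) - 1))"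

text \<open>Grouping the nonzero vectors by the line they span, each group has q - 1 members of
  equal weight, which cancels the q - 1 in \<open>vec_weight\<close>.\<close>

lemma sum_line_weight:
  fixes x :: "nat \<Rightarrow> real"
  shows "(\<Sum>L\<in>{L \<in> subspaces n 1. P L}. line_weight n x L) =
    (\<Sum>v\<in>vecs n - {0 :: nat \<Rightarrow> 'a::{field,finite}}. vec_weight n x v * of_bool (P (fvec.span {v})))"
proof -
  let ?S = "{v \<in> vecs n - {0 :: nat \<Rightarrow> 'a}. P (fvec.span {v})}"
  let ?T = "{L \<in> subspaces n 1. P L} :: (nat \<Rightarrow> 'a) set set"
  have T: "finite ?T"
    by (rule finite_subset[of _ "Pow (vecs n)"]) (auto simp: subspaces_def finite_vecs)
  have "line_weight n x L = (\<Sum>v\<in>{v \<in> ?S. fvec.span {v} = L}. vec_weight n x v)" if L: "L \<in> ?T" for L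
  proof -
    have S: "{v \<in> ?S. fvec.span {v} = L} = L - {0}"
      using L span_line[of L n] subspacesD(2)[of L n 1] by (auto intro: fvec.span_base)
    have "0 \<in> L" "card L = CARD('a)" using L by (auto simp: subspaces_iff_card fvec.subspace_0)
    then have card: "real (card (L - {0})) = real CARD('a) - 1"
      by (simp add: card_Diff_singleton of_nat_diff)
    have "vec_weight n x v = line_weight n x L / (real CARD('a) - 1)" if "v \<in> L - {0}" for v
    proof -
      have "line_index n L = lead v"
        using line_index_span[of v n] span_line[of L n v] that L subspacesD(2) by auto
      then show ?thesis by (simp add: vec_weight_def line_weight_def)
    qed
    then have "(\<Sum>v\<in>L - {0}. vec_weight n x v) =
        (real CARD('a) - 1) * (line_weight n x L / (real CARD('a) - 1))"
      using card by simp
    then show ?thesis using S field_card_gt_one[where 'a = 'a] by simp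
  qed
  then have "(\<Sum>L\<in>?T. line_weight n x L) = (\<Sum>L\<in>?T. \<Sum>v\<in>{v \<in> ?S. fvec.span {v} = L}. vec_weight n x v)"
    by simp
  also have "\<dots> = (\<Sum>v\<in>?S. vec_weight n x v)"
    by (rule sum.group) (use T span_in_lines[of _ n] in \<open>auto simp: finite_vecs\<close>)
  also have "\<dots> = (\<Sum>v\<in>vecs n - {0}. vec_weight n x v * of_bool (P (fvec.span {v})))"
    by (rule sum.mono_neutral_cong_left) (auto simp: finite_vecs)
  finally show ?thesis .
qed

text \<open>Pivot \<open>s\<close> means zero before \<open>s\<close> and nonzero at
  \<open>s\<close>; writing this as a difference of coordinate spaces reduces counting by pivot to
  powers of q.\<close>

lemma lead_eq_Diff_coord_space:
  assumes "s \<in> S"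
  shows "{v \<in> coord_space S - {0 :: nat \<Rightarrow> 'a::field}. lead v = s} =
    coord_space {t \<in> S. s \<le> t} - coord_space {t \<in> S. s < t}"
proof (intro set_eqI iffI)
  fix v :: "nat \<Rightarrow> 'a"
  assume "v \<in> {v \<in> coord_space S - {0}. lead v = s}"
  then have v: "v \<in> coord_space S" "v s \<noteq> 0" "\<And>j. j < s \<Longrightarrow> v j = 0"
    using lead_nonzero less_lead by auto
  then show "v \<in> coord_space {t \<in> S. s \<le> t} - coord_space {t \<in> S. s < t}"
    by (auto simp: coord_space_def not_le)
next
  fix v :: "nat \<Rightarrow> 'a"
  assume v: "v \<in> coord_space {t \<in> S. s \<le> t} - coord_space {t \<in> S. s < t}"
  then have low: "v j = 0" if "j < s" for j using that by (auto simp: coord_space_def)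
  have "v s \<noteq> 0"
    using v by (auto simp: coord_space_def) (metis order_le_less)
  moreover from this low have "lead v = s" by (rule lead_eqI)
  ultimately show "v \<in> {v \<in> coord_space S - {0}. lead v = s}"
    using v by (auto simp: coord_space_def)
qed

lemma card_lead_eq:
  assumes "finite S" "s \<in> S"
  shows "real (card {v \<in> coord_space S - {0 :: nat \<Rightarrow> 'a::{field,finite}}. lead v = s}) =
    (real CARD('a) - 1) * real CARD('a) ^ card {t \<in> S. s < t}"
proof -
  let ?A = "{t \<in> S. s < t}"
  have i: "{t \<in> S. s \<le> t} = insert s ?A" using assms(2) by auto
  have c: "card (insert s ?A) = Suc (card ?A)" using assms(1) by (subst card_insert_disjoint) auto
  have sub: "coord_space ?A \<subseteq> (coord_space (insert s ?A) :: (nat \<Rightarrow> 'a) set)"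
    by (rule coord_space_mono) auto
  show ?thesis
    unfolding lead_eq_Diff_coord_space[OF assms(2)] i
    using assms(1) sub c card_mono[OF finite_coord_space sub]
    by (simp add: card_Diff_subset finite_coord_space card_coord_space of_nat_diff algebra_simps)
qed

text \<open>Grouping by pivot \<open>s\<close>, the number of vectors contributes
  \<open>q - 1\<close>, which cancels, and a power of q whose exponent becomes
  \<open>b_count\<close> when \<open>S\<close> consists of the first values of a
  permutation.\<close>

lemma sum_vec_weight_coord_space:
  assumes "S \<subseteq> {1..n}"
  shows "sum (vec_weight n x) (coord_space S - {0 :: nat \<Rightarrow> 'a::{field,finite}}) =
    (\<Sum>s\<in>S. x s / real CARD('a) ^ (n - s - card {t \<in> S. s < t}))"
proof -
  let ?V = "coord_space S - {0 :: nat \<Rightarrow> 'a}"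
  have S: "finite S" using assms finite_subset by auto
  have q: "1 < real CARD('a)" using field_card_gt_one[where 'a = 'a] by simp
  have lead: "lead ` ?V \<subseteq> S"
  proof (rule image_subsetI)
    fix v :: "nat \<Rightarrow> 'a" assume "v \<in> ?V"
    then show "lead v \<in> S" using lead_nonzero[of v] by (auto simp: coord_space_def)
  qed
  have "(\<Sum>v\<in>{v \<in> ?V. lead v = s}. vec_weight n x v) =
      x s / real CARD('a) ^ (n - s - card {t \<in> S. s < t})" if s: "s \<in> S" for s
  proof -
    \<comment> \<open>Ensures that the natural-number subtraction in the exponent is not
      truncated.\<close>
    have "card {t \<in> S. s < t} \<le> card {s<..n}" using assms by (intro card_mono) auto
    then have le: "card {t \<in> S. s < t} \<le> n - s" by simp
    have "(\<Sum>v\<in>{v \<in> ?V. lead v = s}. vec_weight n x v) =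
        (\<Sum>v\<in>{v \<in> ?V. lead v = s}. x s / (real CARD('a) ^ (n - s) * (real CARD('a) - 1)))"
      by (intro sum.cong) (auto simp: vec_weight_def)
    also have "\<dots> = x s * real CARD('a) ^ card {t \<in> S. s < t} / real CARD('a) ^ (n - s)"
      unfolding sum_constant card_lead_eq[OF S s, where 'a = 'a] using q by simp
    also have "\<dots> = x s / real CARD('a) ^ (n - s - card {t \<in> S. s < t})"
      using q by (subst power_diff[OF _ le]) auto
    finally show ?thesis .
  qed
  then show ?thesis
    using sum.group[OF _ S lead, of "vec_weight n x"] S by (simp add: finite_coord_space)
qed

lemma probability_weighting_vec_weight:
  assumes "1 \<le> n" "\<forall>i\<in>{1..n}. 0 < x i" "(\<Sum>i=1..n. x i) = 1"
  shows "probability_weighting n (vec_weight n x :: (nat \<Rightarrow> 'a::{field,finite}) \<Rightarrow> real)"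
proof
  have q: "1 < real CARD('a)" using field_card_gt_one[where 'a = 'a] by simp
  show "0 < vec_weight n x v" if "v \<in> vecs n" "v \<noteq> 0" for v :: "nat \<Rightarrow> 'a"
    using lead_in_vecs[OF that] assms(2) q by (simp add: vec_weight_def)
  show "0 < n" using assms(1) by simp
  \<comment> \<open>For the full index set the exponent is 0, and the sum reduces to that of the
    \<open>x s\<close>.\<close>
  have "card {t \<in> {1..n}. s < t} = n - s" for s
  proof -
    have "{t \<in> {1..n}. s < t} = {s<..n}" by auto
    then show ?thesis by simp
  qed
  then show "sum (vec_weight n x) (vecs n - {0 :: nat \<Rightarrow> 'a}) = 1"
    using sum_vec_weight_coord_space[of "{1..n}" n x, where 'a = 'a] assms(3)
    by (simp add: vecs_eq_coord_space)
qed

lemma tsetlin_eq_transition: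
  assumes "probability_weighting n (vec_weight n x :: (nat \<Rightarrow> 'a::{field,finite}) \<Rightarrow> real)"
  shows "tsetlin n x \<Phi> G =
    (\<Sum>F\<in>complete_flags n. \<Phi> F * probability_weighting.transition n (vec_weight n x) F (G :: 'a flag))"
  unfolding tsetlin_def sum_line_weight probability_weighting.transition_def[OF assms]
  by (intro sum.cong arg_cong2[where f = "(*)"] refl) (simp add: add_line_span)

lemma stationary_distribution_unique:
  assumes P: "probability_weighting n (vec_weight n x :: (nat \<Rightarrow> 'a::{field,finite}) \<Rightarrow> real)"
  shows "is_stationary_distribution n x \<Phi> \<longleftrightarrow>
    \<Phi> = (probability_weighting.flag_prob n (vec_weight n x) :: 'a flag \<Rightarrow> real)"
proof -
  interpret probability_weighting n "vec_weight n x :: (nat \<Rightarrow> 'a) \<Rightarrow> real" by (rule P)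
  show ?thesis
  proof
    assume \<Phi>: "is_stationary_distribution n x \<Phi>"
    show "\<Phi> = flag_prob"
    proof
      fix F :: "'a flag"
      show "\<Phi> F = flag_prob F"
      proof (cases "F \<in> complete_flags n")
        case True
        then show ?thesis
          using \<Phi> unfolding is_stationary_distribution_def
          by (intro flag_prob_unique) (auto simp flip: tsetlin_eq_transition[OF P])
      next
        case False
        then show ?thesis using \<Phi> by (simp add: flag_prob_outside is_stationary_distribution_def)
      qed
    qed
  next
    assume "\<Phi> = flag_prob"
    then show "is_stationary_distribution n x \<Phi>"
      by (auto simp: is_stationary_distribution_def flag_prob_outside flag_prob_nonneg sum_flag_prob
          tsetlin_eq_transition[OF P] flag_prob_stationary fun_eq_iff)
  qed
qed

section \<open>Lower triangular matrices and permutation flags\<close>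

text \<open>Invertibility is given by an inverse matrix \<open>c\<close> rather than a determinant.
  Comparing entries of the product with the identity row by row shows \<open>c\<close> to be lower
  triangular and \<open>b i i * c i i = 1\<close>.\<close>

lemma lower_borel_diagonal:
  assumes b: "b \<in> lower_borel n" and i: "i \<in> {1..n}"
  shows "b i i \<noteq> 0"
proof -
  obtain c where c: "\<And>i k. i \<in> {1..n} \<Longrightarrow> k \<in> {1..n} \<Longrightarrow>
      (\<Sum>j=1..n. b i j * c j k) = (if i = k then 1 else 0)"
    using b unfolding lower_borel_def invertible_matrix_def by blast
  have lower: "b i j = 0" if "i \<in> {1..n}" "j \<in> {1..n}" "i < j" for i j
    using b that by (auto simp: lower_borel_def)
  \<comment> \<open>\<open>k = i\<close> is the claim; \<open>k > i\<close> gives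
    \<open>c i k = 0\<close>, which removes the terms left of the diagonal in later rows. Terms to
    the right vanish since \<open>b\<close> is lower triangular.\<close>
  have "b i i * c i k = (if i = k then 1 else 0)"
    if "i \<in> {1..n}" "k \<in> {i..n}" for i k
    using that
  proof (induction i arbitrary: k rule: less_induct)
    case (less i)
    have "b i j * c j k = 0" if "j \<in> {1..n} - {i}" for j
    proof (cases "j < i")
      case True
      have j: "j \<in> {1..n}" "j \<in> {j..n}" "k \<in> {j..n}" "j \<noteq> k" using that True less.prems by auto
      have "b j j * c j j = 1" "b j j * c j k = 0" using less.IH[OF True j(1)] j by auto
      then have "c j k = 0" by auto
      then show ?thesis by simp
    qed (use lower that less.prems in auto)
    then have "(\<Sum>j\<in>{1..n} - {i}. b i j * c j k) = 0" by (intro sum.neutral ballI)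
    then have "(\<Sum>j=1..n. b i j * c j k) = b i i * c i k"
      using less.prems by (simp add: sum.remove[of _ i])
    then show ?case using c[of i k] less.prems by simp
  qed
  from this[of i i] i show ?thesis by auto
qed

lemma mat_vec_in_vecs: "mat_vec n b v \<in> vecs n"
  by (simp add: mat_vec_def vecs_def)

lemma mat_vec_add: "mat_vec n b (u + v) = mat_vec n b u + mat_vec n b v"
  by (auto simp: mat_vec_def fun_eq_iff distrib_left sum.distrib)

lemma mat_vec_vscale: "mat_vec n b (vscale c v) = vscale c (mat_vec n b v)"
  by (auto simp: mat_vec_def vscale_def fun_eq_iff sum_distrib_left ac_simps)

lemma mat_vec_zero: "mat_vec n b 0 = 0"
  by (auto simp: mat_vec_def fun_eq_iff)

lemma subspace_mat_vec_image:
  assumes V: "fvec.subspace V"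
  shows "fvec.subspace (mat_vec n b ` V)"
proof (rule fvec.subspaceI)
  show "0 \<in> mat_vec n b ` V"
    using imageI[OF fvec.subspace_0[OF V], of "mat_vec n b"] by (simp add: mat_vec_zero)
qed (auto simp flip: mat_vec_add mat_vec_vscale intro!: imageI fvec.subspace_add[OF V] fvec.subspace_scale[OF V])

text \<open>In row \<open>i \<le> lead v\<close> the terms with \<open>j < lead v\<close> vanish
  through \<open>v\<close> and those with \<open>j > i\<close> through \<open>b\<close>, so only the
  diagonal term at the pivot survives. This is why lower triangular matrices preserve the
  weight.\<close>

lemma mat_vec_lead:
  assumes b: "b \<in> lower_borel n" and v: "v \<in> vecs n" "v \<noteq> 0"
  shows "mat_vec n b v (lead v) \<noteq> 0" "lead (mat_vec n b v) = lead v"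
proof -
  have l: "lead v \<in> {1..n}" using lead_in_vecs[OF v] .
  have zero: "b i j * v j = 0" if "i \<le> lead v" "i \<in> {1..n}" "j \<in> {1..n}" "j \<noteq> lead v \<or> i < lead v" for i j
    using that b less_lead[of j v] by (cases "j < lead v") (auto simp: lower_borel_def)
  have "(\<Sum>j\<in>{1..n} - {lead v}. b (lead v) j * v j) = 0"
    using l by (intro sum.neutral ballI zero) auto
  then have "mat_vec n b v (lead v) = b (lead v) (lead v) * v (lead v)"
    using l by (simp add: mat_vec_def sum.remove[of _ "lead v"])
  then show nz: "mat_vec n b v (lead v) \<noteq> 0"
    using lower_borel_diagonal[OF b l] lead_nonzero[OF v(2)] by simp
  show "lead (mat_vec n b v) = lead v"
    using nz zero l by (intro lead_eqI) (auto simp: mat_vec_def intro!: sum.neutral)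
qed

lemma vec_weight_mat_vec:
  assumes "b \<in> lower_borel n" "v \<in> vecs n"
  shows "vec_weight n x (mat_vec n b v) = vec_weight n x v"
  using mat_vec_lead[OF assms] by (cases "v = 0") (simp_all add: mat_vec_zero vec_weight_def)

lemma bij_betw_mat_vec:
  assumes b: "b \<in> lower_borel n"
  shows "bij_betw (mat_vec n b) (vecs n) (vecs n :: (nat \<Rightarrow> 'a::{field,finite}) set)"
proof -
  have "inj_on (mat_vec n b) (vecs n)"
  proof (rule inj_onI)
    fix u v :: "nat \<Rightarrow> 'a"
    assume uv: "u \<in> vecs n" "v \<in> vecs n" and eq: "mat_vec n b u = mat_vec n b v"
    have "u - v \<in> vecs n" using uv subspace_vecs fvec.subspace_diff by blast
    moreover have "mat_vec n b (u - v) = 0"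
      using eq mat_vec_add[of n b "u - v" v] by simp
    ultimately show "u = v" using mat_vec_lead(1)[OF b, of "u - v"] by (auto simp: fun_eq_iff)
  qed
  then show ?thesis
    unfolding bij_betw_def
    using endo_inj_surj[OF finite_vecs, of "mat_vec n b"] mat_vec_in_vecs by blast
qed

lemma act_flag_in_complete_flags:
  fixes F :: "'a::{field,finite} flag"
  assumes b: "b \<in> lower_borel n" and F: "F \<in> complete_flags n"
  shows "act_flag n b F \<in> complete_flags n"
proof -
  have "mat_vec n b ` V \<in> subspaces n d" if V: "V \<in> subspaces n d" for V d
  proof -
    have "inj_on (mat_vec n b) V"
      using bij_betw_mat_vec[OF b] subspacesD(2)[OF V] by (auto simp: bij_betw_def intro: inj_on_subset)
    then show ?thesis
      using V by (auto simp: subspaces_iff_card card_image mat_vec_in_vecs subspace_mat_vec_image)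
  qed
  moreover have "mat_vec n b ` (F ! i) \<subseteq> mat_vec n b ` (F ! Suc i)" if "i < n" for i
    using F that by (auto simp: complete_flags_def intro!: image_mono)
  ultimately show ?thesis
    using F unfolding complete_flags_def act_flag_def by simp
qed

section \<open>Permutation flags and the product formula\<close>

lemma perm_flag_nth:
  assumes "k \<le> n"
  shows "perm_flag n \<pi> ! k = coord_space (\<pi> ` {1..k})"
  using assms by (simp add: perm_flag_def coord_space_eq_span image_image del: upt_Suc)

lemma perm_image_subset:
  fixes n :: nat
  assumes "\<pi> permutes {1..n}" "k \<le> n"
  shows "\<pi> ` {1..k} \<subseteq> {1..n}"
proof -
  have "\<pi> ` {1..k} \<subseteq> \<pi> ` {1..n}" using assms(2) by (intro image_mono) auto
  then show ?thesis unfolding permutes_image[OF assms(1)] .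
qed

lemma perm_flag_in_complete_flags:
  assumes "\<pi> permutes {1..n}"
  shows "(perm_flag n \<pi> :: 'a::{field,finite} flag) \<in> complete_flags n"
proof -
  have "coord_space (\<pi> ` {1..k}) \<in> (subspaces n k :: (nat \<Rightarrow> 'a) set set)" if "k \<le> n" for k
  proof -
    have "card (\<pi> ` {1..k}) = k"
      using card_image[OF inj_on_subset[OF permutes_inj[OF assms]], of "{1..k}"] by simp
    then show ?thesis
      using coord_space_mono[OF perm_image_subset[OF assms that]]
      by (auto simp: subspaces_iff_card card_coord_space subspace_coord_space vecs_eq_coord_space)
  qed
  moreover have "coord_space (\<pi> ` {1..i}) \<subseteq> (coord_space (\<pi> ` {1..Suc i}) :: (nat \<Rightarrow> 'a) set)" for i
    by (intro coord_space_mono image_mono) auto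
  moreover have "length (perm_flag n \<pi> :: 'a flag) = Suc n" by (simp add: perm_flag_def)
  ultimately show ?thesis by (simp add: complete_flags_def perm_flag_nth)
qed

text \<open>\<open>vec_weight\<close> has a meaningless value at the zero vector, whose
  \<open>lead\<close> is unspecified; so the measures of the two spaces are compared after removing
  0.\<close>

lemma sum_Diff_zero:
  fixes w :: "'b::zero \<Rightarrow> real"
  assumes "finite W" "V \<subseteq> W" "0 \<in> V"
  shows "sum w (W - V) = sum w (W - {0}) - sum w (V - {0})"
proof -
  have "W - V = (W - {0}) - (V - {0})" using assms by auto
  then show ?thesis using assms sum_diff[of "W - {0}" "V - {0}" w] by (simp add: Diff_mono)
qed

text \<open>\<open>M S\<close> is the weight of the nonzero vectors of \<open>coord_space S\<close>.
  Adjoining p = \<open>\<pi> (Suc k)\<close> adds a term for p, multiplies the terms with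
  \<open>s < p\<close> by q, and leaves those with \<open>s > p\<close> alone; the increments are
  the summands of f.\<close>

lemma f_factor_eq_diff:
  fixes x :: "nat \<Rightarrow> real"
  assumes \<pi>: "\<pi> permutes {1..n}" and k: "k < n" and x: "(\<Sum>i=1..n. x i) = 1" and q: "0 < q"
  defines "M \<equiv> \<lambda>S. \<Sum>s\<in>S. x s / real q ^ (n - s - card {t \<in> S. s < t})"
  shows "f_factor q n x \<pi> (Suc k) = M (\<pi> ` {1..Suc k}) - M (\<pi> ` {1..k})"
proof -
  define S where "S = \<pi> ` {1..k}"
  define p where "p = \<pi> (Suc k)"
  define c where "c = b_count \<pi> (Suc k)"
  have T: "\<pi> ` {1..Suc k} = insert p S" by (auto simp: S_def p_def atLeastAtMostSuc_conv)
  have p: "p \<notin> S" using permutes_inj[OF \<pi>] by (auto simp: S_def p_def inj_eq)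
  have fin: "finite S" by (simp add: S_def)
  have sub: "insert p S \<subseteq> {1..n}" using perm_image_subset[OF \<pi>, of "Suc k"] k T by simp
  have c: "c s = card {t \<in> S. s < t}" for s
    by (simp add: c_def b_count_def S_def atLeastLessThanSuc_atLeastAtMost)
  have cp: "{t \<in> insert p S. p < t} = {t \<in> S. p < t}" by auto
  have c': "card {t \<in> insert p S. s < t} = (if s < p then Suc (c s) else c s)" for s
  proof -
    have "{t \<in> insert p S. s < t} = (if s < p then insert p {t \<in> S. s < t} else {t \<in> S. s < t})"
      by auto
    then show ?thesis using p fin by (simp add: c)
  qed
  \<comment> \<open>Adjoining \<open>p\<close> above \<open>s\<close> leaves at most
    \<open>n - s\<close> indices above \<open>s\<close>, so there was room for one more and the
    exponent really drops by one.\<close>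
  have diff: "x s / real q ^ (n - s - Suc (c s)) - x s / real q ^ (n - s - c s) =
      x s / real q ^ (n - s - c s) * (real q - 1)" if "s \<in> S" "s < p" for s
  proof -
    have "Suc (c s) = card {t \<in> insert p S. s < t}" using that by (simp add: c' del: insert_iff)
    also have "\<dots> \<le> card {s<..n}" using sub by (intro card_mono) auto
    finally have "n - s - c s = Suc (n - s - Suc (c s))" by simp
    then show ?thesis using q by (simp add: field_simps)
  qed
  have "f_factor q n x \<pi> (Suc k) = (\<Sum>s\<in>{s \<in> insert p S. s \<le> p}.
      x s / real q ^ (n - s - c s) * (real q - 1) ^ (if s < p then 1 else 0))"
    unfolding f_factor_def T x by (simp add: c_def p_def)
  also have "{s \<in> insert p S. s \<le> p} = insert p {s \<in> S. s < p}" using p by (auto simp: order_le_less)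
  also have "(\<Sum>s\<in>insert p {s \<in> S. s < p}.
      x s / real q ^ (n - s - c s) * (real q - 1) ^ (if s < p then 1 else 0)) =
    x p / real q ^ (n - p - c p) + (\<Sum>s\<in>{s \<in> S. s < p}.
      x s / real q ^ (n - s - Suc (c s)) - x s / real q ^ (n - s - c s))"
    using p fin diff by simp
  \<comment> \<open>Extending the sum to all of \<open>S\<close> is harmless: for
    \<open>s > p\<close> the two counts agree and the terms cancel.\<close>
  also have "(\<Sum>s\<in>{s \<in> S. s < p}. x s / real q ^ (n - s - Suc (c s)) - x s / real q ^ (n - s - c s)) =
    (\<Sum>s\<in>S. x s / real q ^ (n - s - card {t \<in> insert p S. s < t}) - x s / real q ^ (n - s - c s))"
    using fin by (intro sum.mono_neutral_cong_left) (auto simp: c' simp del: insert_iff)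
  finally show ?thesis
    unfolding M_def T S_def[symmetric] using p fin
    by (simp add: sum_subtractf cp c[symmetric] del: insert_iff)
qed

text \<open>Unique existence belongs to the conclusion because
  \<open>stationary_distribution\<close> is a definite description, which carries information only
  if exactly one such vector exists.\<close>

theorem theorem2p21:
  fixes n :: nat and x :: "nat \<Rightarrow> real" and \<Psi> :: "'a::{field,finite} flag \<Rightarrow> real"
  assumes "1 \<le> n"
    and "\<forall>i\<in>{1..n}. 0 < x i"
    and "(\<Sum>i=1..n. x i) = 1"
    and "\<Psi> = stationary_distribution n x"
  shows "(\<exists>!\<Phi> :: 'a flag \<Rightarrow> real. is_stationary_distribution n x \<Phi>) \<and>
    (\<forall>\<pi>. \<pi> permutes {1..n} \<longrightarrow>
      (\<forall>F\<in>perm_class n \<pi>. \<forall>F'\<in>perm_class n \<pi>. \<Psi> F = \<Psi> F') \<and>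
      \<Psi> (perm_flag n \<pi>) =
        (\<Prod>k=1..n. f_factor CARD('a) n x \<pi> k /
          ((\<Sum>i=1..n. x i) -
            (\<Sum>s\<in>\<pi> ` {1..<k}. x s / real CARD('a) ^ (n - s - b_count \<pi> k s))))) \<and>
    (\<Sum>F\<in>complete_flags n. \<Psi> F) = 1"
proof -
  let ?w = "vec_weight n x :: (nat \<Rightarrow> 'a) \<Rightarrow> real"
  have P: "probability_weighting n ?w" using assms(1-3) by (rule probability_weighting_vec_weight)
  interpret probability_weighting n ?w by (rule P)
  note unique = stationary_distribution_unique[OF P]
  have \<Psi>: "\<Psi> = flag_prob"
    unfolding assms(4) stationary_distribution_def unique by simp
  have invariant: "\<Psi> F = \<Psi> (perm_flag n \<pi>)"
    if \<pi>: "\<pi> permutes {1..n}" and F: "F \<in> perm_class n \<pi>" for \<pi> F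
  proof -
    obtain b where b: "b \<in> lower_borel n" "F = act_flag n b (perm_flag n \<pi>)"
      using F by (auto simp: perm_class_def)
    have "act_flag n b (perm_flag n \<pi>) \<in> (complete_flags n :: 'a flag set)"
      using act_flag_in_complete_flags[OF b(1) perm_flag_in_complete_flags[OF \<pi>]] .
    then show ?thesis
      using flag_prob_map[OF perm_flag_in_complete_flags[OF \<pi>] _ bij_betw_mat_vec[OF b(1)]]
        vec_weight_mat_vec[OF b(1)] by (simp add: \<Psi> b(2) act_flag_def)
  qed
  have formula: "\<Psi> (perm_flag n \<pi>) = (\<Prod>k=1..n. f_factor CARD('a) n x \<pi> k /
      ((\<Sum>i=1..n. x i) - (\<Sum>s\<in>\<pi> ` {1..<k}. x s / real CARD('a) ^ (n - s - b_count \<pi> k s))))"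
    if \<pi>: "\<pi> permutes {1..n}" for \<pi>
  proof -
    let ?C = "\<lambda>k. coord_space (\<pi> ` {1..k}) :: (nat \<Rightarrow> 'a) set"
    have zero: "0 \<in> ?C k" for k by (simp add: coord_space_def)
    \<comment> \<open>The spaces of a flag are counted from 0, so the step from position
      \<open>k\<close> to \<open>Suc k\<close> gives factor \<open>Suc k\<close> of the
      product.\<close>
    have num: "sum ?w (?C (Suc k) - ?C k) = f_factor CARD('a) n x \<pi> (Suc k)" if k: "k < n" for k
    proof -
      have "?C k \<subseteq> ?C (Suc k)" by (intro coord_space_mono image_mono) auto
      then have "sum ?w (?C (Suc k) - ?C k) = sum ?w (?C (Suc k) - {0}) - sum ?w (?C k - {0})"
        using zero by (intro sum_Diff_zero finite_coord_space) auto
      moreover have "\<pi> ` {1..Suc k} \<subseteq> {1..n}" "\<pi> ` {1..k} \<subseteq> {1..n}"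
        using perm_image_subset[OF \<pi>] k by simp_all
      ultimately show ?thesis
        using f_factor_eq_diff[OF \<pi> k assms(3), of "CARD('a)"]
        by (simp only: sum_vec_weight_coord_space zero_less_card_finite simp_thms)
    qed
    \<comment> \<open>Complementary measure: the total weight 1, written as the sum of the
      \<open>x i\<close>, minus the weight of the space already reached.\<close>
    have den: "sum ?w (vecs n - ?C k) = (\<Sum>i=1..n. x i) -
        (\<Sum>s\<in>\<pi> ` {1..<Suc k}. x s / real CARD('a) ^ (n - s - b_count \<pi> (Suc k) s))" if k: "k < n" for k
    proof -
      have sub: "\<pi> ` {1..k} \<subseteq> {1..n}" using perm_image_subset[OF \<pi>] k by simp
      then have "?C k \<subseteq> vecs n" unfolding vecs_eq_coord_space by (rule coord_space_mono)
      then have "sum ?w (vecs n - ?C k) = sum ?w (vecs n - {0}) - sum ?w (?C k - {0})"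
        using zero by (intro sum_Diff_zero finite_vecs)
      then show ?thesis
        by (simp only: total_weight sum_vec_weight_coord_space[OF sub] assms(3) b_count_def
            atLeastLessThanSuc_atLeastAtMost)
    qed
    have "\<Psi> (perm_flag n \<pi>) = (\<Prod>k<n. sum ?w (?C (Suc k) - ?C k) / sum ?w (vecs n - ?C k))"
      unfolding \<Psi> flag_prob_eq_prod[OF perm_flag_in_complete_flags[OF \<pi>]]
      by (intro prod.cong) (simp_all add: perm_flag_nth)
    also have "\<dots> = (\<Prod>k<n. f_factor CARD('a) n x \<pi> (Suc k) / ((\<Sum>i=1..n. x i) -
        (\<Sum>s\<in>\<pi> ` {1..<Suc k}. x s / real CARD('a) ^ (n - s - b_count \<pi> (Suc k) s))))"
      by (intro prod.cong refl arg_cong2[where f = "(/)"] num den) simp_all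
    finally show ?thesis by (simp only: prod.atLeast1_atMost_eq One_nat_def)
  qed
  have "\<exists>!\<Phi> :: 'a flag \<Rightarrow> real. is_stationary_distribution n x \<Phi>" unfolding unique by simp
  moreover have "(\<Sum>F\<in>complete_flags n. \<Psi> F) = 1" by (simp add: \<Psi> sum_flag_prob)
  ultimately show ?thesis using invariant formula by auto
qed

end
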